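(* Let $n\ge2$. There is a constant $C$ depending only on $n$ such that for every function $\Omega$ on $\mathbb{R}^n\setminus\{0\}$ that is homogeneous of degree zero, belongs to $L^{n,\infty}(\mathbb{S}^{n-1})$, and has zero average on $\mathbb{S}^{n-1}$ (that is, $\int_{\mathbb{S}^{n-1}}\Omega\,d\sigma=0$), every $f\in C_c^\infty(\mathbb{R}^n)$ and every $x\in\mathbb{R}^n$, $$T^\star_\Omega f(x)\le C\,\|\Omega\|_{L^{n,\infty}(\mathbb{S}^{n-1})}\,I_1(|\nabla f|)(x).$$
   Context: $T^\star_\Omega f(x)=\sup_{t>0}\left|\int_{|y|>t}\frac{\Omega(y)}{|y|^n}f(x-y)\,dy\right|$ is the maximal rough singular integral operator. $I_1g(x)=\int_{\mathbb{R}^n}\frac{g(y)}{|x-y|^{n-1}}\,dy$ is the Riesz potential of order 1. With $\sigma$ the surface measure on $\mathbb{S}^{n-1}$, $\|\Omega\|_{L^{n,\infty}(\mathbb{S}^{n-1})}=\sup_{t>0}t\,\sigma(\{y'\in\mathbb{S}^{n-1}:|\Omega(y')|>t\})^{1/n}$. *)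

theory Defs
  imports "HOL-Analysis.Analysis"
begin

text \<open>
  The surface measure on the unit sphere is defined through polar coordinates: it is
  \<open>n\<close> times the image of Lebesgue measure on the punctured unit ball under the radial
  projection \<open>sgn x = x / |x|\<close>, so that \<open>\<sigma>(A) = n |{r \<theta> : 0 < r < 1, \<theta> \<in> A}|\<close> and
  \<open>dx = r ^ (n - 1) dr d\<sigma>\<close>.  It is completed, so that functions on the sphere are only
  required to be measurable up to null sets.
\<close>

definition sphere_borel_measure :: "(real ^ 'n::finite) measure" where
  "sphere_borel_measure =
     scale_measure (of_nat CARD('n))
       (distr (restrict_space lborel (ball 0 1 - {0})) (restrict_space borel (sphere 0 1)) sgn)"

definition sphere_measure :: "(real ^ 'n::finite) measure" where
  "sphere_measure = completion sphere_borel_measure"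

lemma space_sphere_measure: "space sphere_measure = sphere 0 1"
  by (simp add: sphere_measure_def sphere_borel_measure_def space_scale_measure space_restrict_space)

lemma sgn_measurable_sphere:
  "sgn \<in> restrict_space lborel (ball 0 1 - {0 :: real ^ 'n::finite})
           \<rightarrow>\<^sub>M restrict_space borel (sphere 0 1)"
proof (rule measurable_restrict_space2)
  show "sgn \<in> space (restrict_space lborel (ball 0 1 - {0 :: real ^ 'n})) \<rightarrow> sphere 0 1"
    by (auto simp: space_restrict_space norm_sgn)
  have "(sgn :: real ^ 'n \<Rightarrow> _) \<in> borel_measurable borel"
    unfolding sgn_div_norm [abs_def] by measurable
  then show "sgn \<in> borel_measurable (restrict_space lborel (ball 0 1 - {0 :: real ^ 'n}))"
    by (intro measurable_restrict_space1) simp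
qed

lemma emeasure_sphere_measure:
  fixes A :: "(real ^ 'n::finite) set"
  assumes "A \<in> sets borel" "A \<subseteq> sphere 0 1"
  shows "emeasure sphere_measure A =
           of_nat CARD('n) * emeasure lborel {x. x \<noteq> 0 \<and> norm x < 1 \<and> sgn x \<in> A}"
proof -
  have A: "A \<in> sets (restrict_space borel (sphere 0 1))"
    using assms by (simp add: sets_restrict_space_iff)
  then have "emeasure sphere_measure A =
      of_nat CARD('n) * emeasure (restrict_space lborel (ball 0 1 - {0}))
        (sgn -` A \<inter> space (restrict_space lborel (ball 0 1 - {0})))"
    unfolding sphere_measure_def sphere_borel_measure_def
    by (subst emeasure_completion)
       (simp_all add: emeasure_distr [OF sgn_measurable_sphere A])
  also have "sgn -` A \<inter> space (restrict_space lborel (ball 0 1 - {0})) =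
      {x. x \<noteq> 0 \<and> norm x < 1 \<and> sgn x \<in> A}"
    by (auto simp: space_restrict_space)
  also have "emeasure (restrict_space lborel (ball 0 1 - {0})) \<dots> = emeasure lborel \<dots>"
    by (rule emeasure_restrict_space) auto
  finally show ?thesis .
qed

text \<open>
  The sphere has finite measure, so nothing is lost by using the real-valued
  \<^const>\<open>measure\<close>; the supremum itself may be infinite.
\<close>

definition weak_Ln_norm :: "(real ^ 'n::finite \<Rightarrow> complex) \<Rightarrow> ennreal" where
  "weak_Ln_norm \<Omega> =
     (SUP t\<in>{0<..}. ennreal
        (t * measure sphere_measure {\<theta> \<in> sphere 0 1. t < norm (\<Omega> \<theta>)} powr (1 / real CARD('n))))"

definition in_weak_Ln :: "(real ^ 'n::finite \<Rightarrow> complex) \<Rightarrow> bool" where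
  "in_weak_Ln \<Omega> \<longleftrightarrow> \<Omega> \<in> borel_measurable sphere_measure \<and> weak_Ln_norm \<Omega> < \<infinity>"

text \<open>Functions on \<open>\<real>^n - {0}\<close> are total functions whose value at the origin is irrelevant.\<close>

definition homogeneous_deg_zero :: "(real ^ 'n::finite \<Rightarrow> complex) \<Rightarrow> bool" where
  "homogeneous_deg_zero \<Omega> \<longleftrightarrow> (\<forall>x r. x \<noteq> 0 \<longrightarrow> 0 < r \<longrightarrow> \<Omega> (r *\<^sub>R x) = \<Omega> x)"

primrec C_upto :: "nat \<Rightarrow> (real ^ 'n::finite \<Rightarrow> complex) \<Rightarrow> bool" where
  "C_upto 0 f \<longleftrightarrow> continuous_on UNIV f"
| "C_upto (Suc k) f \<longleftrightarrow>
     f differentiable_on UNIV \<and> (\<forall>v. C_upto k (\<lambda>x. frechet_derivative f (at x) v))"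

definition test_function :: "(real ^ 'n::finite \<Rightarrow> complex) \<Rightarrow> bool" where
  "test_function f \<longleftrightarrow> (\<forall>k. C_upto k f) \<and> compact (closure {x. f x \<noteq> 0})"

definition gradient :: "(real ^ 'n::finite \<Rightarrow> complex) \<Rightarrow> real ^ 'n \<Rightarrow> complex ^ 'n" where
  "gradient f x = (\<chi> i. frechet_derivative f (at x) (axis i 1))"

definition riesz_potential_1 :: "(real ^ 'n::finite \<Rightarrow> real) \<Rightarrow> real ^ 'n \<Rightarrow> real" where
  "riesz_potential_1 g x = (LINT y|lebesgue. g y / norm (x - y) ^ (CARD('n) - 1))"

definition maximal_rough_singular_integral ::
    "(real ^ 'n::finite \<Rightarrow> complex) \<Rightarrow> (real ^ 'n \<Rightarrow> complex) \<Rightarrow> real ^ 'n \<Rightarrow> ennreal" where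
  "maximal_rough_singular_integral \<Omega> f x =
     (SUP t\<in>{0<..}. ennreal (norm
        (LINT y:{y. t < norm y}|lebesgue. \<Omega> y / of_real (norm y ^ CARD('n)) * f (x - y))))"

end

theory Submission
  imports Defs
begin

text \<open>
  Polar coordinates write the truncated integral as a superposition, over the radii \<open>r > t\<close>, of
  the spherical integrals \<open>(1/r) \<integral> \<Omega>(\<theta>) f(x - r\<theta>) d\<sigma>(\<theta>)\<close>.  The theorem
  follows from one estimate on a single sphere (\<open>sphere_integral_le\<close>),
    \<open>|\<integral> \<Omega>(\<theta>) f(x - r\<theta>) d\<sigma>(\<theta>)| \<le> C \<parallel>\<Omega>\<parallel> r \<integral> |\<nabla>f(x - r\<omega>)| d\<sigma>(\<omega>)\<close>,
  because its right-hand side, divided by \<open>r\<close> and integrated over all \<open>r > 0\<close>, is by polar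
  coordinates again a constant times the Riesz potential of \<open>|\<nabla>f|\<close>.  The truncation only discards
  some radii, so the bound is uniform in \<open>t\<close>.

  On the sphere, the zero average of \<open>\<Omega>\<close> allows a constant to be subtracted from
  \<open>f(x - r\<theta>)\<close>.  The constant is the mean over the unit ball \<open>B\<close> of
  \<open>U(z) = f(x - r z/|z|)\<close>, the extension of \<open>f(x - r\<theta>)\<close> that is homogeneous of degree
  zero.  Integration along segments gives the classical Poincare representation on a ball,
    \<open>|U(\<theta>) - mean| \<le> c \<integral>\<^sub>B |\<nabla>U(w)| |w - \<theta>|\<^sup>1\<^sup>-\<^sup>n dw\<close>,
  where \<open>|\<nabla>U(w)| \<le> 2 r |\<nabla>f(x - r w/|w|)| / |w|\<close> (\<open>spherical_poincare\<close>).
  After pairing with \<open>|\<Omega>(\<theta>)|\<close> and writing \<open>w = \<rho>\<omega>\<close>, the identity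
  \<open>|\<rho>\<omega> - \<theta>| = |\<rho>\<theta> - \<omega>|\<close> for unit vectors moves the radial variable from \<open>\<omega>\<close> to
  \<open>\<theta>\<close>, and everything is reduced to a bound, uniform in the unit vector \<open>\<omega>\<close>, for
    \<open>\<integral>\<^sub>B |\<Omega>(y)| |y|\<^sup>-\<^sup>1 |y - \<omega>|\<^sup>1\<^sup>-\<^sup>n dy\<close>
  (\<open>weak_kernel_integral_bound\<close>).  In \<open>n\<close> variables this pairs weak \<open>L\<^sup>n\<close> with weak
  \<open>L\<^sup>n\<^sup>'\<close>, which is the forbidden endpoint of Hoelder's inequality.  But \<open>\<Omega>\<close> does not
  depend on \<open>|y|\<close>, and \<open>1 - |y| \<le> |y - \<omega>|\<close>; so a small power of \<open>|y - \<omega>|\<close> can be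
  replaced by the same power of \<open>1 - |y|\<close>, whose singularity is integrable in the radial
  direction alone.  This gain makes room for a strong \<open>L\<^sup>p\<close> norm with \<open>p < n\<close>, which the
  weak \<open>L\<^sup>n\<close> norm controls.
\<close>

section \<open>Polar coordinates\<close>

lemma borel_ball [measurable]: "ball (a :: 'a::metric_space) r \<in> sets borel"
  by simp

lemma nn_integral_affine:
  fixes f :: "'a::euclidean_space \<Rightarrow> ennreal" and t :: 'a
  assumes [measurable]: "f \<in> borel_measurable borel" and c: "c \<noteq> 0"
  shows "(\<integral>\<^sup>+x. f x \<partial>lborel) = ennreal (\<bar>c\<bar> ^ DIM('a)) * (\<integral>\<^sup>+x. f (t + c *\<^sub>R x) \<partial>lborel)"
  by (subst lborel_affine[OF c, of t])
     (simp add: nn_integral_density nn_integral_distr nn_integral_cmult ennreal_power)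

lemma norm_scaleR_sgn [simp]: "norm y *\<^sub>R sgn y = (y :: 'a::real_normed_vector)"
  by (cases "y = 0") (simp_all add: sgn_div_norm)

text \<open>
  The measure of a set of directions is \<open>n\<close> times the volume of the cone over it in the unit ball.
  It lives on the Borel sets of the whole space, concentrated on the unit sphere, so that Borel
  functions on the space can be integrated against it without restricting them to the sphere.
\<close>

definition surface_measure :: "'a::euclidean_space measure" where
  "surface_measure =
     distr (density lborel (\<lambda>y. of_nat DIM('a) * indicator (ball 0 1) y)) borel sgn"

text \<open>
  The factor \<open>r\<^sup>n\<^sup>-\<^sup>1 dr\<close> of Lebesgue measure in polar coordinates, on the positive half line.
\<close>

definition radial_measure :: "nat \<Rightarrow> real measure" where
  "radial_measure d = density lborel (\<lambda>r. ennreal (r ^ (d - 1)) * indicator {0<..} r)"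

lemma sets_surface_measure [measurable_cong, simp]: "sets surface_measure = sets borel"
  and space_surface_measure [simp]: "space surface_measure = UNIV"
  by (simp_all add: surface_measure_def)

lemma sets_radial_measure [measurable_cong, simp]: "sets (radial_measure d) = sets borel"
  and space_radial_measure [simp]: "space (radial_measure d) = UNIV"
  by (simp_all add: radial_measure_def)

lemma emeasure_surface_measure:
  fixes A :: "'a::euclidean_space set"
  assumes [measurable]: "A \<in> sets borel"
  shows "emeasure surface_measure A =
    of_nat DIM('a) * emeasure lborel {y. norm y < 1 \<and> sgn y \<in> A}"
proof -
  have [measurable]: "sgn -` A \<in> sets borel"
    by (rule measurable_sets_borel[OF borel_measurable_sgn]) simp
  have "emeasure surface_measure A =
      (\<integral>\<^sup>+y. of_nat DIM('a) * (indicator (ball 0 1) y * indicator (sgn -` A) y) \<partial>lborel)"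
    unfolding surface_measure_def
    by (subst emeasure_distr, simp_all, subst emeasure_density)
       (auto simp: mult.assoc intro!: borel_measurable_times_ennreal borel_measurable_indicator)
  also have "\<dots> = of_nat DIM('a) * (\<integral>\<^sup>+y. indicator {y. norm y < 1 \<and> sgn y \<in> A} y \<partial>lborel)"
    by (subst nn_integral_cmult[symmetric])
       (auto intro!: nn_integral_cong split: split_indicator)
  also have "(\<integral>\<^sup>+y. indicator {y. norm y < 1 \<and> sgn y \<in> A} y \<partial>lborel) =
      emeasure lborel {y. norm y < 1 \<and> sgn y \<in> A}"
    by (rule nn_integral_indicator) measurable
  finally show ?thesis .
qed

lemma finite_surface_measure: "finite_measure (surface_measure :: 'a::euclidean_space measure)"
proof
  have "emeasure lborel {y::'a. norm y < 1 \<and> sgn y \<in> UNIV} = emeasure lborel (ball (0::'a) 1)"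
    by (rule arg_cong[where f="emeasure lborel"]) auto
  also have "\<dots> < \<infinity>"
    using emeasure_lborel_ball_finite[of "0::'a" 1] by simp
  finally show "emeasure (surface_measure :: 'a measure) (space surface_measure) \<noteq> \<infinity>"
    by (simp add: emeasure_surface_measure ennreal_mult_eq_top_iff)
qed

interpretation surface: finite_measure surface_measure
  by (rule finite_surface_measure)

lemma emeasure_surface_measure_finite [simp]: "emeasure surface_measure A < top"
  by (simp add: less_top[symmetric])

lemma sigma_finite_radial_measure: "sigma_finite_measure (radial_measure d)"
  unfolding radial_measure_def
  by (subst sigma_finite_measure.sigma_finite_iff_density_finite[OF sigma_finite_lborel])
     (auto intro!: AE_I2 simp: ennreal_mult_eq_top_iff indicator_def)

interpretation radial: sigma_finite_measure "radial_measure d"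
  by (rule sigma_finite_radial_measure)

interpretation polar: pair_sigma_finite "radial_measure d" surface_measure ..

lemma AE_surface_measure: "AE \<theta> in surface_measure. norm \<theta> = 1"
proof (rule AE_I)
  have "emeasure lborel {y. norm y < 1 \<and> sgn y \<in> {\<theta>::'a. norm \<theta> \<noteq> 1}} \<le> emeasure lborel {0::'a}"
    by (rule emeasure_mono) (auto simp: norm_sgn split: if_splits)
  then show "emeasure surface_measure {\<theta> :: 'a. norm \<theta> \<noteq> 1} = 0"
    by (subst emeasure_surface_measure) auto
qed auto

lemma emeasure_cone:
  fixes A :: "'a::euclidean_space set"
  assumes [measurable]: "A \<in> sets borel" and R: "0 < R"
  shows "emeasure lborel {y. norm y < R \<and> sgn y \<in> A} =
    ennreal (R ^ DIM('a)) * emeasure lborel {y. norm y < 1 \<and> sgn y \<in> A}"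
proof -
  have "emeasure lborel {y. norm y < R \<and> sgn y \<in> A} =
      (\<integral>\<^sup>+y. indicator {y. norm y < R \<and> sgn y \<in> A} y \<partial>lborel)"
    by (rule nn_integral_indicator[symmetric]) measurable
  also have "\<dots> = ennreal (R ^ DIM('a)) *
      (\<integral>\<^sup>+y. indicator {y. norm y < R \<and> sgn y \<in> A} (0 + R *\<^sub>R y) \<partial>lborel)"
    using R by (subst nn_integral_affine[where c=R and t=0]) auto
  also have "(\<integral>\<^sup>+y. indicator {y. norm y < R \<and> sgn y \<in> A} (0 + R *\<^sub>R y) \<partial>lborel) =
      (\<integral>\<^sup>+y. indicator {y. norm y < 1 \<and> sgn y \<in> A} y \<partial>lborel)"
    using R by (intro nn_integral_cong) (auto simp: sgn_scaleR split: split_indicator)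
  also have "\<dots> = emeasure lborel {y. norm y < 1 \<and> sgn y \<in> A}"
    by (rule nn_integral_indicator) measurable
  finally show ?thesis .
qed

lemma emeasure_radial_measure_lessThan:
  assumes "1 \<le> d"
  shows "emeasure (radial_measure d) {..<R} = (if 0 < R then ennreal (R ^ d / d) else 0)"
proof -
  have "emeasure (radial_measure d) {..<R} =
      (\<integral>\<^sup>+r. ennreal (r ^ (d - 1)) * indicator {0<..} r * indicator {..<R} r \<partial>lborel)"
    unfolding radial_measure_def by (subst emeasure_density) auto
  also have "\<dots> = (if 0 < R then ennreal (R ^ d / d) else 0)"
  proof (cases "0 < R")
    case True
    have "(\<integral>\<^sup>+r. ennreal (r ^ (d - 1)) * indicator {0<..} r * indicator {..<R} r \<partial>lborel) =
        (\<integral>\<^sup>+r. ennreal (r ^ (d - 1)) * indicator {0..R} r \<partial>lborel)"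
      using AE_lborel_singleton[of 0] AE_lborel_singleton[of R]
      by (intro nn_integral_cong_AE) (auto split: split_indicator)
    also have "\<dots> = ennreal (R ^ d / d - 0 ^ d / d)"
      using assms True
      by (intro nn_integral_FTC_Icc) (auto intro!: derivative_eq_intros)
    finally show ?thesis
      using assms True by (simp add: power_0_left)
  next
    case False
    then have "ennreal (r ^ (d - 1)) * indicator {0<..} r * indicator {..<R} r = 0" for r
      by (auto split: split_indicator)
    with False show ?thesis by (simp only: nn_integral_const if_False) simp
  qed
  finally show ?thesis .
qed

text \<open>
  For a fixed set \<open>B\<close> of directions both sides are measures in \<open>A\<close>.  They agree on the half
  lines \<open>{..<R}\<close>, by the scaling of cones and \<open>\<integral>\<^sub>0\<^sup>R r\<^sup>n\<^sup>-\<^sup>1 dr = R\<^sup>n/n\<close>, and half lines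
  generate the Borel sets.
\<close>

lemma emeasure_polar_rectangle:
  fixes B :: "'a::euclidean_space set"
  assumes [measurable]: "A \<in> sets borel" "B \<in> sets borel"
  shows "emeasure (radial_measure DIM('a)) A * emeasure surface_measure B =
    emeasure lborel {y. norm y \<in> A \<and> sgn y \<in> B}"
proof -
  define M where "M = distr (density lborel (indicator (sgn -` B))) borel (norm :: 'a \<Rightarrow> real)"
  define N where "N = scale_measure (emeasure surface_measure B) (radial_measure DIM('a))"
  have M: "emeasure M A = emeasure lborel {y. norm y \<in> A \<and> sgn y \<in> B}"
    if [measurable]: "A \<in> sets borel" for A
  proof -
    have [measurable]: "sgn -` B \<in> sets borel" "(norm :: 'a \<Rightarrow> real) -` A \<in> sets borel"
      by (rule measurable_sets_borel[OF borel_measurable_sgn], simp)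
         (rule measurable_sets_borel[of _ borel], auto)
    have "emeasure M A = (\<integral>\<^sup>+y. indicator (sgn -` B) y * indicator (norm -` A) y \<partial>lborel)"
      unfolding M_def by (subst emeasure_distr, simp, simp, subst emeasure_density) auto
    also have "\<dots> = (\<integral>\<^sup>+y. indicator {y. norm y \<in> A \<and> sgn y \<in> B} y \<partial>lborel)"
      by (rule nn_integral_cong) (auto split: split_indicator)
    also have "\<dots> = emeasure lborel {y. norm y \<in> A \<and> sgn y \<in> B}"
      by (rule nn_integral_indicator) measurable
    finally show ?thesis .
  qed
  have N: "emeasure N A = emeasure (radial_measure DIM('a)) A * emeasure surface_measure B"
    for A by (simp add: N_def mult.commute)
  have fin: "emeasure lborel {y::'a. norm y < R \<and> sgn y \<in> B} < \<infinity>" for R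
  proof -
    have "emeasure lborel {y::'a. norm y < R \<and> sgn y \<in> B} \<le> emeasure lborel (cball (0::'a) \<bar>R\<bar>)"
      by (intro emeasure_mono) auto
    also have "\<dots> < \<infinity>" 
      using emeasure_lborel_cball_finite[of "0::'a" "\<bar>R\<bar>"] by simp
    finally show ?thesis .
  qed
  have borel: "sets (borel :: real measure) = sigma_sets UNIV (range lessThan)"
    by (subst borel_eq_lessThan) (simp add: lessThan_def eucl_less_def)
  have "M = N"
  proof (rule measure_eqI_generator_eq[where E="range lessThan" and \<Omega>=UNIV and A="\<lambda>i. {..<real i}"])
    show "Int_stable (range lessThan :: real set set)"
    proof (rule Int_stableI_image)
      fix a b :: real
      show "\<exists>c\<in>UNIV. {..<a} \<inter> {..<b} = {..<c}"
        by (rule bexI[of _ "min a b"]) auto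
    qed
  next
    fix X :: "real set" assume "X \<in> range lessThan"
    then obtain R where X: "X = {..<R}" by auto
    show "emeasure M X = emeasure N X"
    proof (cases "0 < R")
      case True
      have "emeasure N X = ennreal (R ^ DIM('a) / DIM('a)) *
          (of_nat DIM('a) * emeasure lborel {y. norm y < 1 \<and> sgn y \<in> B})"
        using True by (simp add: N X emeasure_radial_measure_lessThan emeasure_surface_measure Suc_le_eq)
      also have "\<dots> = ennreal (R ^ DIM('a)) * emeasure lborel {y. norm y < 1 \<and> sgn y \<in> B}"
        using True
        by (simp add: mult.assoc[symmetric] ennreal_of_nat_eq_real_of_nat ennreal_mult'[symmetric])
      finally show ?thesis
        by (simp add: M X emeasure_cone[OF _ True])
    next
      case False
      then have "{y::'a. norm y < R \<and> sgn y \<in> B} = {}"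
        by (smt (verit) Collect_empty_eq norm_ge_zero)
      then have "emeasure lborel {y::'a. norm y < R \<and> sgn y \<in> B} = 0"
        by (simp only: emeasure_empty)
      with False show ?thesis
        by (simp add: M N X emeasure_radial_measure_lessThan Suc_le_eq)
    qed
  next
    show "sets M = sigma_sets UNIV (range lessThan)"
      by (simp add: M_def borel)
    show "sets N = sigma_sets UNIV (range lessThan)"
      by (simp add: N_def borel)
    show "(\<Union>i. {..<real i}) = (UNIV :: real set)"
      using reals_Archimedean2 by auto
    show "emeasure M {..<real i} \<noteq> \<infinity>" for i
      using fin[of "real i"] by (simp add: M)
  qed auto
  then show ?thesis
    using M[of A] N[of A] by simp
qed

lemma polar_coordinates:
  "radial_measure DIM('a) \<Otimes>\<^sub>M surface_measure =
     distr lborel (borel \<Otimes>\<^sub>M borel) (\<lambda>y::'a::euclidean_space. (norm y, sgn y))"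
proof (rule pair_measure_eqI)
  fix A :: "real set" and B :: "'a set"
  assume AB: "A \<in> sets (radial_measure DIM('a))" "B \<in> sets (surface_measure :: 'a measure)"
  then have [measurable]: "A \<in> sets borel" "B \<in> sets borel" by auto
  have "emeasure (distr lborel (borel \<Otimes>\<^sub>M borel) (\<lambda>y::'a. (norm y, sgn y))) (A \<times> B) =
      emeasure lborel {y. norm y \<in> A \<and> sgn y \<in> B}"
    by (subst emeasure_distr) (auto intro!: arg_cong[where f="emeasure lborel"])
  then show "emeasure (radial_measure DIM('a)) A * emeasure surface_measure B =
      emeasure (distr lborel (borel \<Otimes>\<^sub>M borel) (\<lambda>y::'a. (norm y, sgn y))) (A \<times> B)"
    by (simp add: emeasure_polar_rectangle)
qed (auto intro: sigma_finite_radial_measure surface.sigma_finite_measure_axioms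
       cong: sets_pair_measure_cong)

lemma nn_integral_polar:
  fixes h :: "'a::euclidean_space \<Rightarrow> ennreal"
  assumes [measurable]: "h \<in> borel_measurable borel"
  shows "(\<integral>\<^sup>+y. h y \<partial>lborel) =
    (\<integral>\<^sup>+r. \<integral>\<^sup>+\<theta>. h (r *\<^sub>R \<theta>) \<partial>surface_measure \<partial>radial_measure DIM('a))"
proof -
  have "(\<integral>\<^sup>+y. h y \<partial>lborel) = (\<integral>\<^sup>+y. h (norm y *\<^sub>R sgn y) \<partial>lborel)"
    by simp
  also have "\<dots> = (\<integral>\<^sup>+p. h (fst p *\<^sub>R snd p)
      \<partial>distr lborel (borel \<Otimes>\<^sub>M borel) (\<lambda>y::'a. (norm y, sgn y)))"
    by (subst nn_integral_distr) auto
  also have "\<dots> = (\<integral>\<^sup>+r. \<integral>\<^sup>+\<theta>. h (r *\<^sub>R \<theta>) \<partial>surface_measure \<partial>radial_measure DIM('a))"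
    unfolding polar_coordinates[symmetric]
    by (subst surface.nn_integral_fst[symmetric]) auto
  finally show ?thesis .
qed

lemma integral_polar:
  fixes h :: "'a::euclidean_space \<Rightarrow> 'b::{banach, second_countable_topology}"
  assumes h: "integrable lborel h"
  shows "integrable (radial_measure DIM('a)) (\<lambda>r. \<integral>\<theta>. h (r *\<^sub>R \<theta>) \<partial>surface_measure)"
    and "(\<integral>y. h y \<partial>lborel) =
      (\<integral>r. \<integral>\<theta>. h (r *\<^sub>R \<theta>) \<partial>surface_measure \<partial>radial_measure DIM('a))"
proof -
  have [measurable]: "h \<in> borel_measurable borel"
    using h by auto
  have "integrable (distr lborel (borel \<Otimes>\<^sub>M borel) (\<lambda>y::'a. (norm y, sgn y))) (\<lambda>p. h (fst p *\<^sub>R snd p))"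
    using h by (subst integrable_distr_eq) auto
  then have int: "integrable (radial_measure DIM('a) \<Otimes>\<^sub>M surface_measure) (\<lambda>(r, \<theta>). h (r *\<^sub>R \<theta>))"
    unfolding polar_coordinates by (simp add: case_prod_beta')
  show "integrable (radial_measure DIM('a)) (\<lambda>r. \<integral>\<theta>. h (r *\<^sub>R \<theta>) \<partial>surface_measure)"
    using polar.integrable_fst'[OF int] by simp
  have "(\<integral>y. h y \<partial>lborel) = (\<integral>y. h (norm y *\<^sub>R sgn y) \<partial>lborel)"
    by simp
  also have "\<dots> = (\<integral>p. h (fst p *\<^sub>R snd p)
      \<partial>distr lborel (borel \<Otimes>\<^sub>M borel) (\<lambda>y::'a. (norm y, sgn y)))"
    by (subst integral_distr) auto
  also have "\<dots> = (\<integral>r. \<integral>\<theta>. h (r *\<^sub>R \<theta>) \<partial>surface_measure \<partial>radial_measure DIM('a))"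
    using polar.integral_fst'[OF int] by (simp add: polar_coordinates case_prod_beta')
  finally show "(\<integral>y. h y \<partial>lborel) =
      (\<integral>r. \<integral>\<theta>. h (r *\<^sub>R \<theta>) \<partial>surface_measure \<partial>radial_measure DIM('a))" .
qed

section \<open>A Poincare inequality for functions of the direction\<close>

lemma nn_integral_inverse_power_le:
  assumes a: "0 < a" and n: "1 \<le> n"
  shows "(\<integral>\<^sup>+s. ennreal (1 / s ^ Suc n) * indicator {a..1} s \<partial>lborel) \<le> ennreal (1 / (real n * a ^ n))"
proof (cases "a \<le> 1")
  case True
  have "(\<integral>\<^sup>+s. ennreal (1 / s ^ Suc n) * indicator {a..1} s \<partial>lborel) =
      ennreal (- 1 / (real n * 1 ^ n) - - 1 / (real n * a ^ n))"
  proof (rule nn_integral_FTC_Icc[where F="\<lambda>s. - 1 / (real n * s ^ n)"])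
    fix s :: real assume "s \<in> {a..1}"
    with a have s: "0 < s" by simp
    then have "((\<lambda>s. - 1 / (real n * s ^ n)) has_real_derivative 1 / s ^ Suc n) (at s)"
      using n by (auto intro!: derivative_eq_intros simp: field_simps power_Suc[symmetric] power_add[symmetric]
        simp del: power_Suc)
    then show "((\<lambda>s. - 1 / (real n * s ^ n)) has_real_derivative 1 / s ^ Suc n) (at s)" .
    show "0 \<le> 1 / s ^ Suc n" using s by simp
  qed (use True in auto)
  also have "\<dots> \<le> ennreal (1 / (real n * a ^ n))"
    by (intro ennreal_leI) simp
  finally show ?thesis .
qed auto

text \<open>
  The integral-geometric half of the Poincare representation.  For fixed \<open>s\<close>, substitute
  \<open>w = \<theta> + s(z - \<theta>)\<close>: the Jacobian is \<open>s\<^sup>-\<^sup>n\<close>, the factor \<open>|z - \<theta>|\<close> becomes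
  \<open>|w - \<theta>|/s\<close>, and \<open>w\<close> stays in the ball by convexity.  Since \<open>|z - \<theta>| \<le> 2\<close>, only
  \<open>s \<ge> |w - \<theta>|/2\<close> contributes, and the integral of \<open>s\<^sup>-\<^sup>n\<^sup>-\<^sup>1\<close> over these \<open>s\<close>
  produces \<open>|w - \<theta>|\<^sup>-\<^sup>n\<close>.
\<close>

lemma segment_integral_over_ball_le:
  fixes H :: "'a::euclidean_space \<Rightarrow> ennreal" and \<theta> :: 'a
  assumes [measurable]: "H \<in> borel_measurable borel" and \<theta>: "norm \<theta> \<le> 1"
  shows "(\<integral>\<^sup>+z. indicator (ball 0 1) z *
      (\<integral>\<^sup>+s. indicator {0..1} s * ennreal (norm (z - \<theta>)) * H (\<theta> + s *\<^sub>R (z - \<theta>)) \<partial>lborel) \<partial>lborel)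
    \<le> ennreal (2 ^ DIM('a) / DIM('a)) *
      (\<integral>\<^sup>+w. indicator (ball 0 1) w * H w * ennreal (1 / norm (w - \<theta>) ^ (DIM('a) - 1)) \<partial>lborel)"
proof -
  let ?n = "DIM('a)"
  have slice: "(\<integral>\<^sup>+z. indicator (ball 0 1) z * ennreal (norm (z - \<theta>)) * H (\<theta> + s *\<^sub>R (z - \<theta>)) \<partial>lborel)
     \<le> (\<integral>\<^sup>+w. ennreal (1 / s ^ Suc ?n) * indicator {norm (w - \<theta>) / 2..1} s *
            (indicator (ball 0 1) w * ennreal (norm (w - \<theta>)) * H w) \<partial>lborel)" (is "?L \<le> _")
    if s: "0 < s" "s \<le> 1" for s
  proof -
    let ?z = "\<lambda>w. (\<theta> - (1/s) *\<^sub>R \<theta>) + (1/s) *\<^sub>R w"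
    have z\<theta>: "?z w - \<theta> = (1/s) *\<^sub>R (w - \<theta>)" for w by (simp add: algebra_simps)
    have "?L = ennreal (\<bar>1/s\<bar> ^ ?n) * (\<integral>\<^sup>+w. indicator (ball 0 1) (?z w) * ennreal (norm (?z w - \<theta>)) *
        H (\<theta> + s *\<^sub>R (?z w - \<theta>)) \<partial>lborel)"
    proof (rule nn_integral_affine)
      show "(\<lambda>z. indicator (ball 0 1) z * ennreal (norm (z - \<theta>)) * H (\<theta> + s *\<^sub>R (z - \<theta>)))
          \<in> borel_measurable borel" by measurable
    qed (use s in simp)
    also have "\<dots> = (\<integral>\<^sup>+w. ennreal (\<bar>1/s\<bar> ^ ?n) * (indicator (ball 0 1) (?z w) * ennreal (norm (?z w - \<theta>)) *
        H (\<theta> + s *\<^sub>R (?z w - \<theta>))) \<partial>lborel)"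
      by (rule nn_integral_cmult[symmetric]) measurable
    also have "\<dots> \<le> (\<integral>\<^sup>+w. ennreal (1 / s ^ Suc ?n) * indicator {norm (w - \<theta>) / 2..1} s *
            (indicator (ball 0 1) w * ennreal (norm (w - \<theta>)) * H w) \<partial>lborel)"
    proof (rule nn_integral_mono)
      fix w
      show "ennreal (\<bar>1/s\<bar> ^ ?n) * (indicator (ball 0 1) (?z w) * ennreal (norm (?z w - \<theta>)) *
          H (\<theta> + s *\<^sub>R (?z w - \<theta>)))
        \<le> ennreal (1 / s ^ Suc ?n) * indicator {norm (w - \<theta>) / 2..1} s *
            (indicator (ball 0 1) w * ennreal (norm (w - \<theta>)) * H w)"
      proof (cases "?z w \<in> ball 0 1")
        case True
        define z where "z = ?z w"
        have w: "w = (1 - s) *\<^sub>R \<theta> + s *\<^sub>R z"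
          using s by (simp add: z_def algebra_simps)
        have "norm w \<le> (1 - s) * norm \<theta> + s * norm z"
          unfolding w using s by (intro norm_triangle_le) simp
        also have "\<dots> < (1 - s) * 1 + s * 1"
          using s \<theta> True by (intro add_le_less_mono mult_left_mono mult_strict_left_mono) (auto simp: z_def)
        finally have wB: "w \<in> ball 0 1" by simp
        have "norm (w - \<theta>) = s * norm (z - \<theta>)"
          by (simp only: z_def z\<theta> norm_scaleR) (use s in simp)
        also have "norm (z - \<theta>) \<le> 2"
          using norm_triangle_ineq4[of z \<theta>] True \<theta> by (simp add: z_def)
        finally have "norm (w - \<theta>) / 2 \<le> s" using s by simp
        then have "indicator {norm (w - \<theta>) / 2..1} s = (1 :: ennreal)"
          using s by simp
        moreover have "ennreal (\<bar>1/s\<bar> ^ ?n) * ennreal (norm (?z w - \<theta>)) =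
            ennreal (1 / s ^ Suc ?n) * ennreal (norm (w - \<theta>))"
          by (simp only: z\<theta> norm_scaleR) (use s in \<open>simp add: ennreal_mult'[symmetric] field_simps\<close>)
        moreover have "\<theta> + s *\<^sub>R (?z w - \<theta>) = w"
          using s unfolding z\<theta> by simp
        ultimately show ?thesis
          using True wB by (simp add: mult.assoc[symmetric])
      qed simp
    qed
    finally show ?thesis .
  qed
  have "(\<integral>\<^sup>+z. indicator (ball 0 1) z *
      (\<integral>\<^sup>+s. indicator {0..1} s * ennreal (norm (z - \<theta>)) * H (\<theta> + s *\<^sub>R (z - \<theta>)) \<partial>lborel) \<partial>lborel) =
     (\<integral>\<^sup>+z. \<integral>\<^sup>+s. indicator {0<..1} s * (indicator (ball 0 1) z * ennreal (norm (z - \<theta>)) *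
        H (\<theta> + s *\<^sub>R (z - \<theta>))) \<partial>lborel \<partial>lborel)"
    using AE_lborel_singleton[of "0::real"]
    by (subst nn_integral_cmult[symmetric])
       (auto intro!: nn_integral_cong nn_integral_cong_AE simp: mult_ac split: split_indicator)
  also have "\<dots> = (\<integral>\<^sup>+s. \<integral>\<^sup>+z. indicator {0<..1} s * (indicator (ball 0 1) z * ennreal (norm (z - \<theta>)) *
        H (\<theta> + s *\<^sub>R (z - \<theta>))) \<partial>lborel \<partial>lborel)"
    by (rule lborel_pair.Fubini') measurable
  also have "\<dots> \<le> (\<integral>\<^sup>+s. indicator {0<..1} s *
      (\<integral>\<^sup>+w. ennreal (1 / s ^ Suc ?n) * indicator {norm (w - \<theta>) / 2..1} s *
            (indicator (ball 0 1) w * ennreal (norm (w - \<theta>)) * H w) \<partial>lborel) \<partial>lborel)"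
    by (intro nn_integral_mono, subst nn_integral_cmult)
       (auto split: split_indicator intro!: slice simp del: power_Suc)
  also have "\<dots> \<le> (\<integral>\<^sup>+s. \<integral>\<^sup>+w. ennreal (1 / s ^ Suc ?n) * indicator {norm (w - \<theta>) / 2..1} s *
            (indicator (ball 0 1) w * ennreal (norm (w - \<theta>)) * H w) \<partial>lborel \<partial>lborel)"
    by (intro nn_integral_mono) (auto split: split_indicator)
  also have "\<dots> = (\<integral>\<^sup>+w. \<integral>\<^sup>+s. ennreal (1 / s ^ Suc ?n) * indicator {norm (w - \<theta>) / 2..1} s *
            (indicator (ball 0 1) w * ennreal (norm (w - \<theta>)) * H w) \<partial>lborel \<partial>lborel)"
  proof (rule lborel_pair.Fubini')
    have "(\<lambda>p. indicator {p. norm (fst p - \<theta>) / 2 \<le> snd p \<and> snd p \<le> 1} p :: ennreal)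
        \<in> borel_measurable (borel \<Otimes>\<^sub>M borel)"
      by measurable
    moreover have "indicator {norm (w - \<theta>) / 2..1} s =
        (indicator {p. norm (fst p - \<theta>) / 2 \<le> snd p \<and> snd p \<le> 1} (w, s) :: ennreal)" for w s
      by (auto split: split_indicator)
    ultimately have [measurable]: "(\<lambda>p. indicator {norm (fst p - \<theta>) / 2..1} (snd p) :: ennreal)
        \<in> borel_measurable (borel \<Otimes>\<^sub>M borel)"
      by simp
    show "(\<lambda>(w, s). ennreal (1 / s ^ Suc ?n) * indicator {norm (w - \<theta>) / 2..1} s *
            (indicator (ball 0 1) w * ennreal (norm (w - \<theta>)) * H w))
        \<in> borel_measurable (lborel \<Otimes>\<^sub>M lborel)"
      unfolding case_prod_beta' by measurable
  qed
  also have "\<dots> \<le> (\<integral>\<^sup>+w. ennreal (2 ^ ?n / ?n) * (indicator (ball 0 1) w * H w *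
      ennreal (1 / norm (w - \<theta>) ^ (?n - 1))) \<partial>lborel)"
  proof (rule nn_integral_mono_AE)
    show "AE w in lborel. (\<integral>\<^sup>+s. ennreal (1 / s ^ Suc ?n) * indicator {norm (w - \<theta>) / 2..1} s *
            (indicator (ball 0 1) w * ennreal (norm (w - \<theta>)) * H w) \<partial>lborel)
      \<le> ennreal (2 ^ ?n / ?n) * (indicator (ball 0 1) w * H w * ennreal (1 / norm (w - \<theta>) ^ (?n - 1)))"
      using AE_lborel_singleton[of \<theta>]
    proof eventually_elim
      case (elim w)
      then have d: "0 < norm (w - \<theta>)" by simp
      have "(\<integral>\<^sup>+s. ennreal (1 / s ^ Suc ?n) * indicator {norm (w - \<theta>) / 2..1} s *
            (indicator (ball 0 1) w * ennreal (norm (w - \<theta>)) * H w) \<partial>lborel) =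
          (\<integral>\<^sup>+s. ennreal (1 / s ^ Suc ?n) * indicator {norm (w - \<theta>) / 2..1} s \<partial>lborel) *
            (indicator (ball 0 1) w * ennreal (norm (w - \<theta>)) * H w)"
        by (rule nn_integral_multc) measurable
      also have "\<dots> \<le> ennreal (1 / (?n * (norm (w - \<theta>) / 2) ^ ?n)) *
            (indicator (ball 0 1) w * ennreal (norm (w - \<theta>)) * H w)"
        using d by (intro mult_right_mono nn_integral_inverse_power_le) (auto simp: Suc_le_eq)
      also have "\<dots> = (ennreal (1 / (?n * (norm (w - \<theta>) / 2) ^ ?n)) * ennreal (norm (w - \<theta>))) *
            (indicator (ball 0 1) w * H w)"
        by (simp add: mult_ac)
      also have "ennreal (1 / (?n * (norm (w - \<theta>) / 2) ^ ?n)) * ennreal (norm (w - \<theta>)) =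
          ennreal (2 ^ ?n / ?n) * ennreal (1 / norm (w - \<theta>) ^ (?n - 1))"
        using d power_minus_mult[of ?n "norm (w - \<theta>)"]
        by (simp add: ennreal_mult'[symmetric] power_divide field_simps)
      finally show ?case by (simp add: mult_ac)
    qed
  qed
  also have "\<dots> = ennreal (2 ^ ?n / ?n) *
      (\<integral>\<^sup>+w. indicator (ball 0 1) w * H w * ennreal (1 / norm (w - \<theta>) ^ (?n - 1)) \<partial>lborel)"
    by (rule nn_integral_cmult) measurable
  finally show ?thesis .
qed

lemma has_derivative_sgn:
  fixes w :: "'a::real_inner"
  assumes "w \<noteq> 0"
  shows "(sgn has_derivative (\<lambda>v. v /\<^sub>R norm w - ((w \<bullet> v) / norm w ^ 3) *\<^sub>R w)) (at w)"
proof -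
  have "((\<lambda>w. inverse (norm w) *\<^sub>R w) has_derivative (\<lambda>v. v /\<^sub>R norm w - ((w \<bullet> v) / norm w ^ 3) *\<^sub>R w)) (at w)"
    using assms
    by (auto intro!: derivative_eq_intros has_derivative_norm
        simp: sgn_div_norm fun_eq_iff field_simps power3_eq_cube)
       (simp add: inner_commute)
  then show ?thesis
    by (simp add: sgn_div_norm[abs_def])
qed

lemma norm_derivative_sgn_le:
  fixes w v :: "'a::real_inner"
  shows "norm (v /\<^sub>R norm w - ((w \<bullet> v) / norm w ^ 3) *\<^sub>R w) \<le> 2 * norm v / norm w"
proof (cases "w = 0")
  case False
  have "norm (v /\<^sub>R norm w - ((w \<bullet> v) / norm w ^ 3) *\<^sub>R w) \<le>
      norm (v /\<^sub>R norm w) + norm (((w \<bullet> v) / norm w ^ 3) *\<^sub>R w)"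
    by (rule norm_triangle_ineq4)
  also have "\<dots> = norm v / norm w + \<bar>w \<bullet> v\<bar> / norm w ^ 2"
    using False by (simp add: field_simps power3_eq_cube power2_eq_square)
  also have "\<dots> \<le> norm v / norm w + (norm w * norm v) / norm w ^ 2"
    by (intro add_left_mono divide_right_mono Cauchy_Schwarz_ineq2) auto
  also have "\<dots> = 2 * norm v / norm w"
    using False by (simp add: power2_eq_square)
  finally show ?thesis .
qed simp

text \<open>
  The fundamental theorem of calculus along the segment from \<open>\<theta>\<close> to \<open>z\<close> for the function
  \<open>w \<mapsto> f(x - r w/|w|)\<close>.  This function is singular at the origin, which is why the segment must
  avoid it.
\<close>

lemma spherical_difference_le_segment_integral:
  fixes f :: "'a::euclidean_space \<Rightarrow> 'b::banach" and g :: "'a \<Rightarrow> real"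
  assumes f': "\<And>y. (f has_derivative f' y) (at y)"
    and bound: "\<And>y v. norm (f' y v) \<le> g y * norm v"
    and g: "continuous_on UNIV g" and r: "0 \<le> r"
    and avoid: "0 \<notin> closed_segment \<theta> z"
  shows "ennreal (norm (f (x - r *\<^sub>R sgn z) - f (x - r *\<^sub>R sgn \<theta>))) \<le>
    (\<integral>\<^sup>+s. indicator {0..1} s * ennreal (norm (z - \<theta>)) *
       ennreal (2 * r * g (x - r *\<^sub>R sgn (\<theta> + s *\<^sub>R (z - \<theta>))) / norm (\<theta> + s *\<^sub>R (z - \<theta>))) \<partial>lborel)"
proof -
  define p where "p s = \<theta> + s *\<^sub>R (z - \<theta>)" for s
  define S where "S w v = v /\<^sub>R norm w - ((w \<bullet> v) / norm w ^ 3) *\<^sub>R w" for w v :: 'a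
  define h where "h s = norm (z - \<theta>) * (2 * r * g (x - r *\<^sub>R sgn (p s)) / norm (p s))" for s
  define D where "D s = f' (x - r *\<^sub>R sgn (p s)) (- r *\<^sub>R S (p s) (z - \<theta>))" for s
  have g0: "0 \<le> g y" for y
  proof -
    obtain i :: 'a where "i \<in> Basis" using nonempty_Basis by blast
    then show ?thesis
      using order_trans[OF norm_ge_zero bound[of y i]] by simp
  qed
  have p: "p s \<noteq> 0" if "s \<in> {0..1}" for s
  proof
    assume "p s = 0"
    then have "0 = (1 - s) *\<^sub>R \<theta> + s *\<^sub>R z" by (simp add: p_def algebra_simps)
    with that avoid show False by (auto simp: closed_segment_def)
  qed
  have "(D has_integral f (x - r *\<^sub>R sgn (p 1)) - f (x - r *\<^sub>R sgn (p 0))) {0..1}"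
  proof (rule fundamental_theorem_of_calculus)
    fix s :: real assume s: "s \<in> {0..1}"
    have "((\<lambda>s. x - r *\<^sub>R sgn (p s)) has_derivative (\<lambda>d. - r *\<^sub>R S (p s) (d *\<^sub>R (z - \<theta>)))) (at s)"
      unfolding S_def p_def
      by (rule derivative_eq_intros has_derivative_compose[OF _ has_derivative_sgn] refl p[OF s, unfolded p_def] | simp)+
    then have "((\<lambda>s. f (x - r *\<^sub>R sgn (p s))) has_derivative
        (\<lambda>d. f' (x - r *\<^sub>R sgn (p s)) (- r *\<^sub>R S (p s) (d *\<^sub>R (z - \<theta>))))) (at s)"
      by (rule has_derivative_compose[OF _ f'])
    also have "(\<lambda>d. f' (x - r *\<^sub>R sgn (p s)) (- r *\<^sub>R S (p s) (d *\<^sub>R (z - \<theta>)))) = (\<lambda>d. d *\<^sub>R D s)"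
    proof
      fix d
      have "- r *\<^sub>R S (p s) (d *\<^sub>R (z - \<theta>)) = d *\<^sub>R (- r *\<^sub>R S (p s) (z - \<theta>))"
        by (simp add: S_def algebra_simps)
      then show "f' (x - r *\<^sub>R sgn (p s)) (- r *\<^sub>R S (p s) (d *\<^sub>R (z - \<theta>))) = d *\<^sub>R D s"
        unfolding D_def
        by (metis f' has_derivative_bounded_linear bounded_linear.linear linear_cmul)
    qed
    finally show "((\<lambda>s. f (x - r *\<^sub>R sgn (p s))) has_vector_derivative D s) (at s within {0..1})"
      unfolding has_vector_derivative_def by (rule has_derivative_at_withinI)
  qed simp
  then have D: "(D has_integral f (x - r *\<^sub>R sgn z) - f (x - r *\<^sub>R sgn \<theta>)) {0..1}"
    by (simp add: p_def)
  have "continuous_on {0..1} p"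
    unfolding p_def by (intro continuous_intros)
  then have "continuous_on {0..1} h"
    unfolding h_def using p
    by (intro continuous_intros continuous_on_compose2[OF g]) auto
  then have h: "h integrable_on {0..1}"
    by (rule integrable_continuous_real)
  have "norm (f (x - r *\<^sub>R sgn z) - f (x - r *\<^sub>R sgn \<theta>)) = norm (integral {0..1} D)"
    using D by (simp add: integral_unique)
  also have "\<dots> \<le> integral {0..1} h"
  proof (rule Henstock_Kurzweil_Integration.integral_norm_bound_integral[OF _ h])
    fix s :: real assume "s \<in> {0..1}"
    have "norm (D s) \<le> g (x - r *\<^sub>R sgn (p s)) * (r * norm (S (p s) (z - \<theta>)))"
      unfolding D_def using bound[of "x - r *\<^sub>R sgn (p s)" "- r *\<^sub>R S (p s) (z - \<theta>)"] r by simp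
    also have "\<dots> \<le> g (x - r *\<^sub>R sgn (p s)) * (r * (2 * norm (z - \<theta>) / norm (p s)))"
      unfolding S_def using r g0 by (intro mult_left_mono norm_derivative_sgn_le) auto
    finally show "norm (D s) \<le> h s" by (simp add: h_def mult_ac)
  qed (use D in auto)
  finally have "ennreal (norm (f (x - r *\<^sub>R sgn z) - f (x - r *\<^sub>R sgn \<theta>))) \<le> ennreal (integral {0..1} h)"
    by (rule ennreal_leI)
  also have "\<dots> = (\<integral>\<^sup>+s. ennreal (h s) * indicator {0..1} s \<partial>lborel)"
    using r g0
    by (intro nn_integral_has_integral_lebesgue'[symmetric] integrable_integral h) (simp add: h_def)
  also have "\<dots> = (\<integral>\<^sup>+s. indicator {0..1} s * ennreal (norm (z - \<theta>)) *
       ennreal (2 * r * g (x - r *\<^sub>R sgn (p s)) / norm (p s)) \<partial>lborel)"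
  proof (rule nn_integral_cong)
    fix s
    have "ennreal (h s) = ennreal (norm (z - \<theta>)) *
        ennreal (2 * r * g (x - r *\<^sub>R sgn (p s)) / norm (p s))"
      unfolding h_def using r g0 by (intro ennreal_mult) simp_all
    then show "ennreal (h s) * indicator {0..1} s = indicator {0..1} s * ennreal (norm (z - \<theta>)) *
        ennreal (2 * r * g (x - r *\<^sub>R sgn (p s)) / norm (p s))"
      by (simp add: mult_ac)
  qed
  finally show ?thesis by (simp add: p_def)
qed

text \<open>
  The two preceding estimates combined.  The points \<open>z\<close> whose segment to \<open>\<theta>\<close> meets the origin
  lie on the line through \<open>\<theta>\<close>, a null set in dimension at least two.
\<close>

lemma spherical_poincare:
  fixes f :: "'a::euclidean_space \<Rightarrow> 'b::{banach, second_countable_topology}" and g :: "'a \<Rightarrow> real"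
  assumes dim: "2 \<le> DIM('a)"
    and f': "\<And>y. (f has_derivative f' y) (at y)"
    and bound: "\<And>y v. norm (f' y v) \<le> g y * norm v"
    and g: "continuous_on UNIV g" and r: "0 \<le> r"
    and \<theta>: "norm \<theta> = 1"
  shows "(\<integral>\<^sup>+z. indicator (ball 0 1) z * ennreal (norm (f (x - r *\<^sub>R sgn z) - f (x - r *\<^sub>R \<theta>))) \<partial>lborel)
    \<le> ennreal (2 ^ DIM('a) / DIM('a)) *
      (\<integral>\<^sup>+w. indicator (ball 0 1) w * ennreal (2 * r * g (x - r *\<^sub>R sgn w) / norm w) *
         ennreal (1 / norm (w - \<theta>) ^ (DIM('a) - 1)) \<partial>lborel)"
proof -
  have "negligible (span {\<theta>})"
  proof (rule negligible_lowdim)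
    have "dim (span {\<theta>}) \<le> card {\<theta>}" by (simp add: dim_le_card')
    then show "dim (span {\<theta>}) < DIM('a)" using dim by simp
  qed
  then have "AE z in lborel. z \<notin> span {\<theta>}"
    unfolding negligible_iff_null_sets
    by (drule_tac AE_not_in) (simp only: AE_completion_iff)
  have seg: "0 \<notin> closed_segment \<theta> z" if "z \<notin> span {\<theta>}" for z
  proof
    assume "0 \<in> closed_segment \<theta> z"
    then obtain s where s: "0 = (1 - s) *\<^sub>R \<theta> + s *\<^sub>R z" by (auto simp: closed_segment_def)
    have "s \<noteq> 0" using s \<theta> by auto
    then have "z = (- (1 - s) / s) *\<^sub>R \<theta>"
      using s by (metis (no_types, lifting) add.inverse_unique divide_inverse mult.commute
          real_vector_affinity_eq scaleR_minus_left scaleR_one scaleR_scaleR eq_neg_iff_add_eq_0 right_inverse)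
    then show False using that by (metis span_base span_scale singletonI)
  qed
  have [measurable]: "g \<in> borel_measurable borel"
    using g by (rule borel_measurable_continuous_onI)
  have "(\<integral>\<^sup>+z. indicator (ball 0 1) z * ennreal (norm (f (x - r *\<^sub>R sgn z) - f (x - r *\<^sub>R \<theta>))) \<partial>lborel)
    \<le> (\<integral>\<^sup>+z. indicator (ball 0 1) z *
      (\<integral>\<^sup>+s. indicator {0..1} s * ennreal (norm (z - \<theta>)) *
       ennreal (2 * r * g (x - r *\<^sub>R sgn (\<theta> + s *\<^sub>R (z - \<theta>))) / norm (\<theta> + s *\<^sub>R (z - \<theta>))) \<partial>lborel) \<partial>lborel)"
  proof (rule nn_integral_mono_AE)
    have sgn\<theta>: "sgn \<theta> = \<theta>" using \<theta> by (simp add: sgn_div_norm)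
    show "AE z in lborel. indicator (ball 0 1) z * ennreal (norm (f (x - r *\<^sub>R sgn z) - f (x - r *\<^sub>R \<theta>)))
      \<le> indicator (ball 0 1) z *
      (\<integral>\<^sup>+s. indicator {0..1} s * ennreal (norm (z - \<theta>)) *
       ennreal (2 * r * g (x - r *\<^sub>R sgn (\<theta> + s *\<^sub>R (z - \<theta>))) / norm (\<theta> + s *\<^sub>R (z - \<theta>))) \<partial>lborel)"
      using \<open>AE z in lborel. z \<notin> span {\<theta>}\<close>
    proof eventually_elim
      case (elim z)
      show ?case
        using spherical_difference_le_segment_integral[OF f' bound g r seg[OF elim], of x] 
        by (intro mult_left_mono) (auto simp: sgn\<theta>)
    qed
  qed
  also have "\<dots> \<le> ennreal (2 ^ DIM('a) / DIM('a)) *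
      (\<integral>\<^sup>+w. indicator (ball 0 1) w * ennreal (2 * r * g (x - r *\<^sub>R sgn w) / norm w) *
         ennreal (1 / norm (w - \<theta>) ^ (DIM('a) - 1)) \<partial>lborel)"
    using \<theta> by (intro segment_integral_over_ball_le) auto
  finally show ?thesis .
qed

section \<open>Weak integrability and power singularities\<close>

text \<open>
  If \<open>a > 1\<close>, the single index \<open>k\<close> with \<open>2\<^sup>k < a \<le> 2\<^sup>k\<^sup>+\<^sup>1\<close> already dominates.
\<close>

lemma powr_le_dyadic_sum:
  assumes a: "0 \<le> a" and p: "0 < p"
  shows "ennreal (a powr p) \<le>
    1 + (\<Sum>k. ennreal (2 powr (p * (real k + 1))) * indicator {2 ^ k<..} a)"
proof (cases "a \<le> 1")
  case True
  then have "a powr p \<le> 1" using a p by (simp add: powr_le1)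
  then have "ennreal (a powr p) \<le> 1" by simp
  then show ?thesis by (meson add_increasing2 order_refl order_trans zero_le)
next
  case False
  define m where "m = (LEAST m. a \<le> 2 ^ m)"
  have "\<exists>m. a \<le> 2 ^ m"
    using real_arch_pow[of 2 a] by (auto intro: less_imp_le)
  then have m: "a \<le> 2 ^ m" unfolding m_def by (rule LeastI_ex)
  with False have "m \<noteq> 0" by (intro notI) simp
  then obtain k where k: "m = Suc k" using not0_implies_Suc by blast
  have "\<not> a \<le> 2 ^ k"
    using k not_less_Least[of k "\<lambda>m. a \<le> 2 ^ m"] by (simp add: m_def)
  have "a powr p \<le> (2 ^ m) powr p"
    using a p m by (intro powr_mono2) auto
  also have "(2 ^ m) powr p = 2 powr (p * (real k + 1))"
  proof -
    have "(2 ^ m) powr p = (2 powr real m) powr p"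
      by (simp only: powr_realpow zero_less_numeral)
    also have "\<dots> = 2 powr (p * (real k + 1))"
      by (simp only: powr_powr k of_nat_Suc) (simp add: algebra_simps)
    finally show ?thesis .
  qed
  finally have "ennreal (a powr p) \<le> ennreal (2 powr (p * (real k + 1))) * indicator {2 ^ k<..} a"
    using \<open>\<not> a \<le> 2 ^ k\<close> by (simp add: ennreal_leI)
  also have "\<dots> \<le> (\<Sum>k. ennreal (2 powr (p * (real k + 1))) * indicator {2 ^ k<..} a)"
  proof -
    have "F k \<le> suminf F" for F :: "nat \<Rightarrow> ennreal"
      using sum_le_suminf[of F "{k}"] by simp
    then show ?thesis .
  qed
  finally show ?thesis by (simp add: add_increasing)
qed

text \<open>
  On a finite measure space weak \<open>L\<^sup>q\<close> is contained in \<open>L\<^sup>p\<close> for \<open>p < q\<close>: the dyadic level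
  sets contribute a geometric series of ratio \<open>2\<^sup>p\<^sup>-\<^sup>q\<close>.
\<close>

lemma (in finite_measure) nn_integral_powr_weak_bound:
  assumes [measurable]: "\<phi> \<in> borel_measurable M" and nonneg: "\<And>x. 0 \<le> \<phi> x"
    and p: "0 < p" "p < q"
    and weak: "\<And>t. 0 < t \<Longrightarrow> measure M {x \<in> space M. t < \<phi> x} \<le> t powr (- q)"
  shows "(\<integral>\<^sup>+x. ennreal (\<phi> x powr p) \<partial>M) \<le>
    emeasure M (space M) + ennreal (2 powr p / (1 - 2 powr (p - q)))"
proof -
  have "(\<integral>\<^sup>+x. ennreal (\<phi> x powr p) \<partial>M) \<le>
      (\<integral>\<^sup>+x. 1 + (\<Sum>k. ennreal (2 powr (p * (real k + 1))) * indicator {2 ^ k<..} (\<phi> x)) \<partial>M)"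
    using nonneg p by (intro nn_integral_mono powr_le_dyadic_sum)
  also have "\<dots> = emeasure M (space M) +
      (\<Sum>k. \<integral>\<^sup>+x. ennreal (2 powr (p * (real k + 1))) * indicator {2 ^ k<..} (\<phi> x) \<partial>M)"
    by (subst nn_integral_add) (auto simp: nn_integral_suminf)
  also have "(\<Sum>k. \<integral>\<^sup>+x. ennreal (2 powr (p * (real k + 1))) * indicator {2 ^ k<..} (\<phi> x) \<partial>M) \<le>
      (\<Sum>k. ennreal (2 powr p * (2 powr (p - q)) ^ k))"
  proof (intro suminf_le summableI)
    fix k
    have "(\<integral>\<^sup>+x. ennreal (2 powr (p * (real k + 1))) * indicator {2 ^ k<..} (\<phi> x) \<partial>M) =
        ennreal (2 powr (p * (real k + 1))) * (\<integral>\<^sup>+x. indicator {x \<in> space M. 2 ^ k < \<phi> x} x \<partial>M)"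
      by (subst nn_integral_cmult[symmetric])
         (auto intro!: nn_integral_cong split: split_indicator)
    also have "(\<integral>\<^sup>+x. indicator {x \<in> space M. 2 ^ k < \<phi> x} x \<partial>M) = ennreal (measure M {x \<in> space M. 2 ^ k < \<phi> x})"
      by (simp add: emeasure_eq_measure)
    also have "ennreal (2 powr (p * (real k + 1))) * \<dots> \<le>
        ennreal (2 powr (p * (real k + 1))) * ennreal ((2 ^ k) powr (- q))"
      by (intro mult_left_mono ennreal_leI weak) auto
    also have "\<dots> = ennreal (2 powr p * (2 powr (p - q)) ^ k)"
    proof -
      have "2 powr (p * (real k + 1)) * (2 ^ k) powr (- q) = 2 powr (p * (real k + 1)) * 2 powr (real k * (- q))"
        by (simp only: powr_powr[symmetric] powr_realpow zero_less_numeral)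
      also have "\<dots> = 2 powr p * 2 powr ((p - q) * real k)"
        by (simp only: powr_add[symmetric]) (simp add: algebra_simps)
      also have "\<dots> = 2 powr p * (2 powr (p - q)) ^ k"
        by (subst powr_power) (simp_all add: mult.commute)
      finally show ?thesis by (simp add: ennreal_mult'[symmetric])
    qed
    finally show "(\<integral>\<^sup>+x. ennreal (2 powr (p * (real k + 1))) * indicator {2 ^ k<..} (\<phi> x) \<partial>M) \<le>
        ennreal (2 powr p * (2 powr (p - q)) ^ k)" .
  qed
  also have "(\<Sum>k. ennreal (2 powr p * (2 powr (p - q)) ^ k)) =
      ennreal (2 powr p / (1 - 2 powr (p - q)))"
  proof -
    have "2 powr (p - q) < (1::real)"
      using p powr_less_mono[of "p - q" 0 "2::real"] by simp
    then have "(\<lambda>k. 2 powr p * (2 powr (p - q)) ^ k) sums (2 powr p * (1 / (1 - 2 powr (p - q))))"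
      by (intro sums_mult geometric_sums) simp
    then show ?thesis
      by (subst suminf_ennreal2) (auto simp: sums_iff)
  qed
  finally show ?thesis by (simp add: add_left_mono)
qed

lemma nn_integral_radial_measure:
  assumes [measurable]: "h \<in> borel_measurable borel"
  shows "(\<integral>\<^sup>+r. h r \<partial>radial_measure d) = (\<integral>\<^sup>+r. ennreal (r ^ (d - 1)) * indicator {0<..} r * h r \<partial>lborel)"
  unfolding radial_measure_def by (subst nn_integral_density) auto

lemma nn_integral_powr_Ioo_finite:
  fixes e R :: real
  assumes e: "-1 < e"
  shows "(\<integral>\<^sup>+r. ennreal (r powr e) * indicator {0<..<R} r \<partial>lborel) < top"
proof -
  have "((\<lambda>r. r powr e) has_integral (max R 0 powr (e + 1) / (e + 1))) {0..max R 0}"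
    using e by (intro has_integral_powr_from_0) auto
  from nn_integral_has_integral_lebesgue'[OF _ this]
  have "(\<integral>\<^sup>+r. ennreal (r powr e) * indicator {0..max R 0} r \<partial>lborel) < top"
    by simp
  moreover have "(\<integral>\<^sup>+r. ennreal (r powr e) * indicator {0<..<R} r \<partial>lborel) \<le>
      (\<integral>\<^sup>+r. ennreal (r powr e) * indicator {0..max R 0} r \<partial>lborel)"
    by (intro nn_integral_mono) (auto split: split_indicator)
  ultimately show ?thesis by (rule le_less_trans[rotated])
qed

lemma nn_integral_norm_powr_ball_finite:
  fixes \<gamma> R :: real
  assumes \<gamma>: "\<gamma> < DIM('a::euclidean_space)"
  shows "(\<integral>\<^sup>+y. indicator (ball (0::'a) R) y * ennreal (norm y powr - \<gamma>) \<partial>lborel) < top"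
proof -
  let ?n = "DIM('a)"
  have "(\<integral>\<^sup>+y. indicator (ball (0::'a) R) y * ennreal (norm y powr - \<gamma>) \<partial>lborel) =
      (\<integral>\<^sup>+r. \<integral>\<^sup>+\<theta>. indicator (ball 0 R) (r *\<^sub>R \<theta>) * ennreal (norm (r *\<^sub>R \<theta> :: 'a) powr - \<gamma>)
        \<partial>surface_measure \<partial>radial_measure ?n)"
    by (rule nn_integral_polar) measurable
  also have "\<dots> = (\<integral>\<^sup>+r. \<integral>\<^sup>+\<theta>. indicator {..<R} \<bar>r\<bar> * ennreal (\<bar>r\<bar> powr - \<gamma>)
        \<partial>(surface_measure :: 'a measure) \<partial>radial_measure ?n)"
  proof (rule nn_integral_cong, rule nn_integral_cong_AE)
    fix r
    show "AE \<theta> in surface_measure. indicator (ball 0 R) (r *\<^sub>R \<theta>) *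
        ennreal (norm (r *\<^sub>R \<theta> :: 'a) powr - \<gamma>) = indicator {..<R} \<bar>r\<bar> * ennreal (\<bar>r\<bar> powr - \<gamma>)"
      using AE_surface_measure by eventually_elim (simp split: split_indicator)
  qed
  also have "\<dots> = (\<integral>\<^sup>+r. indicator {..<R} \<bar>r\<bar> * ennreal (\<bar>r\<bar> powr - \<gamma>) \<partial>radial_measure ?n) *
      emeasure (surface_measure :: 'a measure) UNIV"
    by (simp, subst nn_integral_multc) auto
  also have "\<dots> < top"
  proof (rule ennreal_mult_less_top[THEN iffD2], intro disjI2 conjI)
    have "(\<integral>\<^sup>+r. indicator {..<R} \<bar>r\<bar> * ennreal (\<bar>r\<bar> powr - \<gamma>) \<partial>radial_measure ?n) =
        (\<integral>\<^sup>+r. ennreal (r powr (real ?n - 1 - \<gamma>)) * indicator {0<..<R} r \<partial>lborel)"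
    proof (subst nn_integral_radial_measure, measurable, rule nn_integral_cong)
      fix r :: real
      show "ennreal (r ^ (?n - 1)) * indicator {0<..} r * (indicator {..<R} \<bar>r\<bar> * ennreal (\<bar>r\<bar> powr - \<gamma>)) =
          ennreal (r powr (real ?n - 1 - \<gamma>)) * indicator {0<..<R} r"
      proof (cases "0 < r")
        case True
        have "r ^ (?n - 1) * r powr - \<gamma> = r powr (real ?n - 1 - \<gamma>)"
          using True by (simp add: powr_realpow[symmetric] powr_add[symmetric] of_nat_diff Suc_le_eq)
        then show ?thesis
          using True by (auto simp: ennreal_mult'[symmetric] split: split_indicator)
      qed auto
    qed
    also have "\<dots> < top"
      using \<gamma> by (intro nn_integral_powr_Ioo_finite) simp
    finally show "(\<integral>\<^sup>+r. indicator {..<R} \<bar>r\<bar> * ennreal (\<bar>r\<bar> powr - \<gamma>) \<partial>radial_measure ?n) < top" .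
    show "emeasure (surface_measure :: 'a measure) UNIV < top"
      by simp
  qed
  finally show ?thesis .
qed

lemma nn_integral_norm_diff_powr_le:
  fixes \<omega> :: "'a::euclidean_space" and \<gamma> :: real
  assumes \<gamma>: "\<gamma> < DIM('a)" and \<omega>: "norm \<omega> \<le> R'"
  shows "(\<integral>\<^sup>+y. indicator (ball 0 R) y * ennreal (norm (y - \<omega>) powr - \<gamma>) \<partial>lborel) \<le>
    (\<integral>\<^sup>+y. indicator (ball (0::'a) (R + R')) y * ennreal (norm y powr - \<gamma>) \<partial>lborel)"
proof -
  have "(\<integral>\<^sup>+y. indicator (ball 0 R) y * ennreal (norm (y - \<omega>) powr - \<gamma>) \<partial>lborel) =
      ennreal (\<bar>1\<bar> ^ DIM('a)) *
      (\<integral>\<^sup>+y. indicator (ball 0 R) (\<omega> + 1 *\<^sub>R y) * ennreal (norm (\<omega> + 1 *\<^sub>R y - \<omega>) powr - \<gamma>) \<partial>lborel)"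
    by (rule nn_integral_affine) auto
  also have "\<dots> \<le> (\<integral>\<^sup>+y. indicator (ball (0::'a) (R + R')) y * ennreal (norm y powr - \<gamma>) \<partial>lborel)"
  proof -
    have "norm y < R + R'" if "norm (\<omega> + y) < R" for y
      using norm_triangle_ineq4[of "\<omega> + y" \<omega>] that \<omega> by simp
    then show ?thesis
      by (simp, intro nn_integral_mono) (auto split: split_indicator)
  qed
  finally show ?thesis .
qed

text \<open>
  Young's inequality without the optimal constants: compare \<open>b\<close> with \<open>a\<^sup>p\<^sup>-\<^sup>1\<close>.
\<close>

lemma mult_le_powr_add_powr:
  fixes a b p :: real
  assumes a: "0 \<le> a" and b: "0 \<le> b" and p: "1 < p"
  shows "a * b \<le> a powr p + b powr (p / (p - 1))"
proof (cases "b \<le> a powr (p - 1)")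
  case True
  then have "a * b \<le> a * a powr (p - 1)"
    using a by (rule mult_left_mono)
  also have "\<dots> = a powr p"
    using a by (cases "a = 0") (simp_all add: powr_mult_base)
  finally show ?thesis by (simp add: add_increasing2)
next
  case False
  then have "(a powr (p - 1)) powr (1 / (p - 1)) \<le> b powr (1 / (p - 1))"
    using p by (intro powr_mono2) auto
  then have "a \<le> b powr (1 / (p - 1))"
    using a p by (simp add: powr_powr)
  then have "a * b \<le> b powr (1 / (p - 1)) * b"
    using b by (rule mult_right_mono)
  also have "\<dots> = b powr (1 / (p - 1) + 1)"
    using b by (cases "b = 0") (simp_all add: powr_add)
  also have "1 / (p - 1) + 1 = p / (p - 1)"
    using p by (simp add: field_simps)
  finally show ?thesis by (simp add: add_increasing)
qed

section \<open>The kernel estimate\<close>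

lemma nn_integral_one_minus_powr_finite:
  "(\<integral>\<^sup>+r. indicator {0<..<1} r * ennreal ((1 - r) powr (- 3 / 4)) \<partial>lborel) < top"
proof -
  have "(\<integral>\<^sup>+r. indicator {0<..<1} r * ennreal ((1 - r) powr (- 3 / 4)) \<partial>lborel) =
      ennreal \<bar>-1\<bar> * (\<integral>\<^sup>+r. indicator {0<..<1} (1 + (-1) * r) * ennreal ((1 - (1 + (-1) * r)) powr (- 3 / 4)) \<partial>lborel)"
    by (rule nn_integral_real_affine) auto
  also have "\<dots> = (\<integral>\<^sup>+r. ennreal (r powr (- 3 / 4)) * indicator {0<..<1} r \<partial>lborel)"
    by (auto intro!: nn_integral_cong split: split_indicator)
  also have "\<dots> < top"
    by (rule nn_integral_powr_Ioo_finite) simp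
  finally show ?thesis .
qed

text \<open>
  Write \<open>|y - \<omega>|\<^sup>1\<^sup>-\<^sup>n = |y - \<omega>|\<^sup>-\<^sup>c |y - \<omega>|\<^sup>c\<^sup>-\<^sup>(\<^sup>n\<^sup>-\<^sup>1\<^sup>)\<close>, estimate the first factor by
  \<open>(1 - |y|)\<^sup>-\<^sup>c\<close>, and apply Young's inequality with exponent \<open>p < n\<close> to
  \<open>\<phi> (1 - |y|)\<^sup>-\<^sup>c\<close> and the second factor.  In the first resulting term the direction and the
  radius separate; the second is a power singularity at \<open>\<omega>\<close> of order \<open>\<gamma>\<close>, integrable if
  \<open>\<gamma> < n\<close>.
\<close>

lemma weak_kernel_integral_bound:
  assumes dim: "2 \<le> DIM('a::euclidean_space)"
  obtains K :: ennreal where "K < top"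
    and "\<And>(\<phi> :: 'a \<Rightarrow> real) \<omega>. \<phi> \<in> borel_measurable borel \<Longrightarrow> (\<And>\<theta>. 0 \<le> \<phi> \<theta>) \<Longrightarrow>
      (\<And>t. 0 < t \<Longrightarrow> measure surface_measure {\<theta>. t < \<phi> \<theta>} \<le> t powr (- real DIM('a))) \<Longrightarrow> norm \<omega> = 1 \<Longrightarrow>
      (\<integral>\<^sup>+y. indicator (ball 0 1) y * ennreal (\<phi> (sgn y) / norm y * (1 / norm (y - \<omega>) ^ (DIM('a) - 1))) \<partial>lborel) \<le> K"
proof -
  define n where "n = real DIM('a)"
  have n: "2 \<le> n" using dim by (simp add: n_def)
  \<comment> \<open>Two requirements fix the exponents: \<open>c p < 1\<close> for the radial integral of
    \<open>(1 - r)\<^sup>-\<^sup>c\<^sup>p\<close>, and \<open>\<gamma> = (n - 1 - c) p / (p - 1) < n\<close>.  With \<open>p = n - a\<close> and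
    \<open>c p = 1 - b\<close> the second one reads \<open>a + b < 1\<close>; the choice is \<open>a = 1/2\<close>, \<open>b = 1/4\<close>.\<close>
  define p where "p = n - 1 / 2"
  define c where "c = 3 / (4 * p)"
  define \<gamma> where "\<gamma> = n - 1 / (4 * n - 6)"
  have p: "0 < p" "1 < p" "p < n" using n by (auto simp: p_def)
  have c: "0 < c" "c * p = 3 / 4" using p by (auto simp: c_def)
  have "0 < 1 / (4 * n - 6)" "1 / (4 * n - 6) \<le> 1"
    using n by (simp_all add: divide_le_eq)
  then have \<gamma>: "0 \<le> \<gamma>" "\<gamma> < n"
    unfolding \<gamma>_def using n by linarith+
  have exponent: "(c - (n - 1)) * (p / (p - 1)) = - \<gamma>"
  proof -
    have "(c - (n - 1)) * p = 3 / 4 - (n - 1) * p"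
      using c(2) by (simp add: left_diff_distrib)
    also have "\<dots> = - \<gamma> * (p - 1)"
      using n by (simp add: p_def \<gamma>_def field_simps)
    finally show ?thesis using p by (simp add: field_simps)
  qed
  define L where "L = emeasure (surface_measure :: 'a measure) UNIV + ennreal (2 powr p / (1 - 2 powr (p - n)))"
  define I where "I = (\<integral>\<^sup>+r. indicator {0<..<1} r * ennreal ((1 - r) powr (- 3 / 4)) \<partial>lborel)"
  define J where "J \<delta> R = (\<integral>\<^sup>+y. indicator (ball (0::'a) R) y * ennreal (norm y powr - \<delta>) \<partial>lborel)" for \<delta> R :: real
  define K where "K = I * L + (ennreal 2 * J \<gamma> 2 + ennreal (2 powr \<gamma>) * J 1 1)"
  have "L < top"
    by (simp add: L_def)
  moreover have "I < top"
    unfolding I_def by (rule nn_integral_one_minus_powr_finite)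
  moreover have "J \<delta> R < top" if "\<delta> < n" for \<delta> R
    using that unfolding J_def n_def by (rule nn_integral_norm_powr_ball_finite)
  ultimately have fin: "K < top"
    using \<gamma> n by (auto simp: K_def ennreal_mult_less_top)
  have bound: "(\<integral>\<^sup>+y. indicator (ball 0 1) y *
      ennreal (\<phi> (sgn y) / norm y * (1 / norm (y - \<omega>) ^ (DIM('a) - 1))) \<partial>lborel) \<le> K"
    if [measurable]: "\<phi> \<in> borel_measurable borel" and nonneg: "\<And>\<theta>. 0 \<le> \<phi> \<theta>"
      and weak: "\<And>t. 0 < t \<Longrightarrow> measure surface_measure {\<theta>. t < \<phi> \<theta>} \<le> t powr (- n)" and \<omega>: "norm \<omega> = 1"
    for \<phi> :: "'a \<Rightarrow> real" and \<omega> :: 'a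
  proof -
    have young: "\<phi> (sgn y) / norm y * (1 / norm (y - \<omega>) ^ (DIM('a) - 1)) \<le>
        \<phi> (sgn y) powr p / norm y * (1 - norm y) powr (- 3 / 4) + norm (y - \<omega>) powr - \<gamma> / norm y"
      if y: "norm y < 1" for y
    proof -
      let ?d = "norm (y - \<omega>)"
      have d: "1 - norm y \<le> ?d" "0 < ?d"
        using norm_triangle_ineq2[of \<omega> y] \<omega> y by (auto simp: norm_minus_commute)
      have "\<phi> (sgn y) * (1 / ?d ^ (DIM('a) - 1)) = \<phi> (sgn y) * (?d powr - c * ?d powr (c - (n - 1)))"
      proof -
        have "1 / ?d ^ (DIM('a) - 1) = ?d powr - (n - 1)"
          using d dim powr_realpow[of ?d "DIM('a) - 1"]
          unfolding powr_minus n_def by (simp add: of_nat_diff divide_inverse)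
        also have "\<dots> = ?d powr - c * ?d powr (c - (n - 1))"
          by (simp add: powr_add[symmetric])
        finally show ?thesis by (rule arg_cong)
      qed
      also have "\<dots> \<le> \<phi> (sgn y) * ((1 - norm y) powr - c * ?d powr (c - (n - 1)))"
        using d c y nonneg by (intro mult_left_mono mult_right_mono powr_mono2') auto
      also have "\<dots> = (\<phi> (sgn y) * (1 - norm y) powr - c) * ?d powr (c - (n - 1))"
        by simp
      also have "\<dots> \<le> (\<phi> (sgn y) * (1 - norm y) powr - c) powr p + (?d powr (c - (n - 1))) powr (p / (p - 1))"
        using nonneg p by (intro mult_le_powr_add_powr) auto
      also have "(\<phi> (sgn y) * (1 - norm y) powr - c) powr p = \<phi> (sgn y) powr p * (1 - norm y) powr (- 3 / 4)"
        using nonneg by (simp add: powr_mult powr_powr c(2))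
      also have "(?d powr (c - (n - 1))) powr (p / (p - 1)) = ?d powr - \<gamma>"
        by (simp only: powr_powr exponent)
      finally have "\<phi> (sgn y) * (1 / ?d ^ (DIM('a) - 1)) / norm y \<le>
          (\<phi> (sgn y) powr p * (1 - norm y) powr (- 3 / 4) + ?d powr - \<gamma>) / norm y"
        by (rule divide_right_mono) simp
      then show ?thesis by (simp add: add_divide_distrib mult_ac)
    qed
    \<comment> \<open>The factor \<open>1/|y|\<close> and the singularity at \<open>\<omega>\<close> do not interact: one of
      \<open>|y|\<close>, \<open>|y - \<omega>|\<close> is at least \<open>1/2\<close>.\<close>
    have far: "norm (y - \<omega>) powr - \<gamma> / norm y \<le> 2 * norm (y - \<omega>) powr - \<gamma> + 2 powr \<gamma> * norm y powr - 1"
      for y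
    proof (cases "1 / 2 \<le> norm y")
      case True
      then have "norm (y - \<omega>) powr - \<gamma> / norm y \<le> norm (y - \<omega>) powr - \<gamma> / (1 / 2)"
        by (intro divide_left_mono) auto
      then show ?thesis by (simp add: add_increasing2)
    next
      case False
      then have "1 / 2 \<le> norm (y - \<omega>)"
        using norm_triangle_ineq2[of \<omega> y] \<omega> by (simp add: norm_minus_commute)
      then have "norm (y - \<omega>) powr - \<gamma> \<le> (1 / 2) powr - \<gamma>"
        using \<gamma> by (intro powr_mono2') auto
      also have "\<dots> = 2 powr \<gamma>"
        by (simp add: powr_minus_divide powr_divide)
      finally have "norm (y - \<omega>) powr - \<gamma> / norm y \<le> 2 powr \<gamma> / norm y"
        by (rule divide_right_mono) simp
      also have "\<dots> = 2 powr \<gamma> * norm y powr - 1"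
        by (cases "y = 0") (simp_all add: powr_minus_divide)
      finally show ?thesis by (simp add: add_increasing)
    qed
    have "(\<integral>\<^sup>+y. indicator (ball 0 1) y *
        ennreal (\<phi> (sgn y) / norm y * (1 / norm (y - \<omega>) ^ (DIM('a) - 1))) \<partial>lborel) \<le>
      (\<integral>\<^sup>+y. indicator (ball 0 1) y * ennreal (\<phi> (sgn y) powr p / norm y * (1 - norm y) powr (- 3 / 4)) +
        (ennreal 2 * (indicator (ball 0 1) y * ennreal (norm (y - \<omega>) powr - \<gamma>)) +
         ennreal (2 powr \<gamma>) * (indicator (ball 0 1) y * ennreal (norm y powr - 1))) \<partial>lborel)"
    proof (rule nn_integral_mono)
      fix y
      show "indicator (ball 0 1) y * ennreal (\<phi> (sgn y) / norm y * (1 / norm (y - \<omega>) ^ (DIM('a) - 1))) \<le>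
        indicator (ball 0 1) y * ennreal (\<phi> (sgn y) powr p / norm y * (1 - norm y) powr (- 3 / 4)) +
        (ennreal 2 * (indicator (ball 0 1) y * ennreal (norm (y - \<omega>) powr - \<gamma>)) +
         ennreal (2 powr \<gamma>) * (indicator (ball 0 1) y * ennreal (norm y powr - 1)))"
      proof (cases "norm y < 1")
        case True
        have "ennreal (\<phi> (sgn y) / norm y * (1 / norm (y - \<omega>) ^ (DIM('a) - 1))) \<le>
          ennreal (\<phi> (sgn y) powr p / norm y * (1 - norm y) powr (- 3 / 4) +
            (2 * norm (y - \<omega>) powr - \<gamma> + 2 powr \<gamma> * norm y powr - 1))"
          using young[OF True] far[of y] by (intro ennreal_leI) linarith
        also have "\<dots> = ennreal (\<phi> (sgn y) powr p / norm y * (1 - norm y) powr (- 3 / 4)) +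
          (ennreal 2 * ennreal (norm (y - \<omega>) powr - \<gamma>) + ennreal (2 powr \<gamma>) * ennreal (norm y powr - 1))"
          by (simp only: ennreal_plus ennreal_mult zero_le_mult_iff zero_le_divide_iff norm_ge_zero powr_ge_zero
               add_nonneg_nonneg zero_le_numeral simp_thms mult_nonneg_nonneg divide_nonneg_nonneg)
        finally show ?thesis using True by simp
      qed simp
    qed
    also have "\<dots> = (\<integral>\<^sup>+y. indicator (ball 0 1) y *
          ennreal (\<phi> (sgn y) powr p / norm y * (1 - norm y) powr (- 3 / 4)) \<partial>lborel) +
        (ennreal 2 * (\<integral>\<^sup>+y. indicator (ball 0 1) y * ennreal (norm (y - \<omega>) powr - \<gamma>) \<partial>lborel) +
         ennreal (2 powr \<gamma>) * J 1 1)"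
      unfolding J_def by (simp add: nn_integral_add nn_integral_cmult)
    also have "\<dots> \<le> K"
      unfolding K_def
    proof (intro add_mono mult_left_mono)
      show "(\<integral>\<^sup>+y. indicator (ball 0 1) y * ennreal (norm (y - \<omega>) powr - \<gamma>) \<partial>lborel) \<le> J \<gamma> 2"
        using nn_integral_norm_diff_powr_le[of \<gamma> \<omega> 1 1] \<gamma> \<omega> by (simp add: J_def n_def)
      have "(\<integral>\<^sup>+y. indicator (ball 0 1) y * ennreal (\<phi> (sgn y) powr p / norm y * (1 - norm y) powr (- 3 / 4)) \<partial>lborel) =
        (\<integral>\<^sup>+r. \<integral>\<^sup>+\<theta>. indicator (ball 0 1) (r *\<^sub>R \<theta>) * ennreal (\<phi> (sgn (r *\<^sub>R \<theta>)) powr p / norm (r *\<^sub>R \<theta>) *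
          (1 - norm (r *\<^sub>R \<theta>)) powr (- 3 / 4)) \<partial>surface_measure \<partial>radial_measure DIM('a))"
        by (rule nn_integral_polar) measurable
      also have "\<dots> = (\<integral>\<^sup>+r. ennreal (r ^ (DIM('a) - 1)) * indicator {0<..} r *
          (\<integral>\<^sup>+\<theta>. indicator (ball 0 1) (r *\<^sub>R \<theta>) * ennreal (\<phi> (sgn (r *\<^sub>R \<theta>)) powr p / norm (r *\<^sub>R \<theta>) *
          (1 - norm (r *\<^sub>R \<theta>)) powr (- 3 / 4)) \<partial>surface_measure) \<partial>lborel)"
        by (rule nn_integral_radial_measure) measurable
      also have "\<dots> \<le> (\<integral>\<^sup>+r. indicator {0<..<1} r * ennreal ((1 - r) powr (- 3 / 4)) * L \<partial>lborel)"
      proof (rule nn_integral_mono)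
        fix r :: real
        show "ennreal (r ^ (DIM('a) - 1)) * indicator {0<..} r *
          (\<integral>\<^sup>+\<theta>. indicator (ball 0 1) (r *\<^sub>R \<theta>) * ennreal (\<phi> (sgn (r *\<^sub>R \<theta>)) powr p / norm (r *\<^sub>R \<theta>) *
          (1 - norm (r *\<^sub>R \<theta>)) powr (- 3 / 4)) \<partial>surface_measure) \<le>
          indicator {0<..<1} r * ennreal ((1 - r) powr (- 3 / 4)) * L"
        proof (cases "0 < r")
          case True
          have "(\<integral>\<^sup>+\<theta>. indicator (ball 0 1) (r *\<^sub>R \<theta>) * ennreal (\<phi> (sgn (r *\<^sub>R \<theta>)) powr p / norm (r *\<^sub>R \<theta>) *
              (1 - norm (r *\<^sub>R \<theta>)) powr (- 3 / 4)) \<partial>surface_measure) =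
            (\<integral>\<^sup>+\<theta>. indicator {0<..<1} r * ennreal ((1 - r) powr (- 3 / 4) / r) * ennreal (\<phi> \<theta> powr p) \<partial>surface_measure)"
          proof (rule nn_integral_cong_AE)
            show "AE \<theta> in surface_measure. indicator (ball 0 1) (r *\<^sub>R \<theta>) *
                ennreal (\<phi> (sgn (r *\<^sub>R \<theta>)) powr p / norm (r *\<^sub>R \<theta>) * (1 - norm (r *\<^sub>R \<theta>)) powr (- 3 / 4)) =
              indicator {0<..<1} r * ennreal ((1 - r) powr (- 3 / 4) / r) * ennreal (\<phi> \<theta> powr p)"
              using AE_surface_measure
            proof eventually_elim
              case (elim \<theta>)
              then have "sgn (r *\<^sub>R \<theta>) = \<theta>" using True by (simp add: sgn_scaleR) (simp add: sgn_div_norm)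
              then show ?case
                using elim True by (auto simp: ennreal_mult'[symmetric] mult_ac split: split_indicator)
            qed
          qed
          also have "\<dots> = indicator {0<..<1} r * ennreal ((1 - r) powr (- 3 / 4) / r) *
              (\<integral>\<^sup>+\<theta>. ennreal (\<phi> \<theta> powr p) \<partial>surface_measure)"
            by (rule nn_integral_cmult) measurable
          also have "\<dots> \<le> indicator {0<..<1} r * ennreal ((1 - r) powr (- 3 / 4) / r) * L"
            using surface.nn_integral_powr_weak_bound[of \<phi> p n] nonneg p weak
            by (intro mult_left_mono) (auto simp: L_def)
          finally have "ennreal (r ^ (DIM('a) - 1)) * indicator {0<..} r *
            (\<integral>\<^sup>+\<theta>. indicator (ball 0 1) (r *\<^sub>R \<theta>) * ennreal (\<phi> (sgn (r *\<^sub>R \<theta>)) powr p / norm (r *\<^sub>R \<theta>) *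
              (1 - norm (r *\<^sub>R \<theta>)) powr (- 3 / 4)) \<partial>surface_measure) \<le>
            ennreal (r ^ (DIM('a) - 1)) * (indicator {0<..<1} r * ennreal ((1 - r) powr (- 3 / 4) / r) * L)"
            using True by (simp add: mult_left_mono)
          \<comment> \<open>In dimension at least two the volume factor absorbs \<open>1/|y|\<close>.\<close>
          also have "\<dots> = indicator {0<..<1} r * ennreal (r ^ (DIM('a) - 2) * (1 - r) powr (- 3 / 4)) * L"
          proof -
            have "DIM('a) - 1 = Suc (DIM('a) - 2)" using dim by simp
            then have "r ^ (DIM('a) - 1) * ((1 - r) powr (- 3 / 4) / r) = r ^ (DIM('a) - 2) * (1 - r) powr (- 3 / 4)"
              using True by simp
            then show ?thesis
              using True by (auto simp: mult.assoc[symmetric] ennreal_mult'[symmetric] split: split_indicator)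
          qed
          also have "\<dots> \<le> indicator {0<..<1} r * ennreal ((1 - r) powr (- 3 / 4)) * L"
            using True
            by (auto split: split_indicator intro!: mult_right_mono ennreal_leI mult_left_le_one_le power_le_one)
          finally show ?thesis .
        qed simp
      qed
      also have "\<dots> = I * L"
        unfolding I_def by (rule nn_integral_multc) measurable
      finally show "(\<integral>\<^sup>+y. indicator (ball 0 1) y *
          ennreal (\<phi> (sgn y) powr p / norm y * (1 - norm y) powr (- 3 / 4)) \<partial>lborel) \<le> I * L" .
    qed auto
    finally show ?thesis .
  qed
  show thesis
    by (rule that[OF fin]) (rule bound[unfolded n_def])
qed

section \<open>The estimate on one sphere\<close>

interpretation surface_lborel: pair_sigma_finite surface_measure lborel ..

lemma AE_radial_measure: "AE r in radial_measure d. 0 < r"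
  unfolding radial_measure_def by (subst AE_density) (auto split: split_indicator)

text \<open>
  Both squares equal \<open>\<rho>\<^sup>2 - 2 \<rho> (\<theta> \<bullet> \<omega>) + 1\<close>.
\<close>

lemma norm_scaleR_diff_swap:
  fixes \<theta> \<omega> :: "'a::real_inner"
  assumes "norm \<theta> = 1" "norm \<omega> = 1"
  shows "norm (\<rho> *\<^sub>R \<omega> - \<theta>) = norm (\<rho> *\<^sub>R \<theta> - \<omega>)"
proof -
  have "norm (\<rho> *\<^sub>R \<omega> - \<theta>) ^ 2 = norm (\<rho> *\<^sub>R \<theta> - \<omega>) ^ 2"
    using assms by (simp add: power2_norm_eq_inner inner_diff inner_commute algebra_simps norm_eq_1)
  then show ?thesis by simp
qed

text \<open>
  The bilinear form between \<open>\<phi>\<close> and \<open>G\<close> that results from the Poincare inequality.  In polar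
  coordinates \<open>w = \<rho>\<omega>\<close>, and after \<open>|\<rho>\<omega> - \<theta>|\<close> is replaced by \<open>|\<rho>\<theta> - \<omega>|\<close>,
  the pair \<open>(\<rho>, \<theta>)\<close> forms polar coordinates of a point \<open>y = \<rho>\<theta>\<close>; the inner integral
  is then the one bounded by \<open>weak_kernel_integral_bound\<close>.
\<close>

lemma sphere_pairing_le:
  assumes dim: "2 \<le> DIM('a::euclidean_space)"
  obtains K :: ennreal where "K < top"
    and "\<And>(\<phi> :: 'a \<Rightarrow> real) G. \<phi> \<in> borel_measurable borel \<Longrightarrow> G \<in> borel_measurable borel \<Longrightarrow> (\<And>\<theta>. 0 \<le> \<phi> \<theta>) \<Longrightarrow>
      (\<And>t. 0 < t \<Longrightarrow> measure surface_measure {\<theta>. t < \<phi> \<theta>} \<le> t powr (- real DIM('a))) \<Longrightarrow>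
      (\<integral>\<^sup>+\<theta>. ennreal (\<phi> \<theta>) * (\<integral>\<^sup>+w. indicator (ball 0 1) w * (G (sgn w) * ennreal (1 / norm w)) *
         ennreal (1 / norm (w - \<theta>) ^ (DIM('a) - 1)) \<partial>lborel) \<partial>surface_measure)
      \<le> K * (\<integral>\<^sup>+\<omega>. G \<omega> \<partial>surface_measure)"
proof -
  let ?n = "DIM('a)"
  obtain K :: ennreal where K: "K < top"
    and kernel: "\<And>\<phi> \<omega>::'a. \<phi> \<in> borel_measurable borel \<Longrightarrow> (\<And>\<theta>. 0 \<le> \<phi> \<theta>) \<Longrightarrow>
      (\<And>t. 0 < t \<Longrightarrow> measure surface_measure {\<theta>. t < \<phi> \<theta>} \<le> t powr (- real ?n)) \<Longrightarrow> norm \<omega> = 1 \<Longrightarrow>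
      (\<integral>\<^sup>+y. indicator (ball 0 1) y * ennreal (\<phi> (sgn y) / norm y * (1 / norm (y - \<omega>) ^ (?n - 1))) \<partial>lborel) \<le> K"
    by (rule weak_kernel_integral_bound[OF dim], rule that, assumption) blast
  have bound: "(\<integral>\<^sup>+\<theta>. ennreal (\<phi> \<theta>) * (\<integral>\<^sup>+w. indicator (ball 0 1) w * (G (sgn w) * ennreal (1 / norm w)) *
         ennreal (1 / norm (w - \<theta>) ^ (?n - 1)) \<partial>lborel) \<partial>surface_measure)
      \<le> K * (\<integral>\<^sup>+\<omega>. G \<omega> \<partial>surface_measure)"
    if [measurable]: "\<phi> \<in> borel_measurable borel" "G \<in> borel_measurable borel"
      and nonneg: "\<And>\<theta>. 0 \<le> \<phi> \<theta>"
      and weak: "\<And>t. 0 < t \<Longrightarrow> measure surface_measure {\<theta>. t < \<phi> \<theta>} \<le> t powr (- real ?n)"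
    for \<phi> :: "'a \<Rightarrow> real" and G
  proof -
    define h where "h w \<theta> = ennreal (\<phi> \<theta>) * (indicator (ball 0 1) w * (G (sgn w) * ennreal (1 / norm w)) *
         ennreal (1 / norm (w - \<theta>) ^ (?n - 1)))" for w \<theta>
    define k where "k \<omega> y = indicator (ball 0 1) y * ennreal (\<phi> (sgn y) / norm y * (1 / norm (y - \<omega>) ^ (?n - 1)))"
      for \<omega> y :: 'a
    have [measurable]: "case_prod h \<in> borel_measurable (borel \<Otimes>\<^sub>M borel)"
      unfolding h_def case_prod_beta' by measurable
    have [measurable]: "case_prod k \<in> borel_measurable (borel \<Otimes>\<^sub>M borel)"
      unfolding k_def case_prod_beta' by measurable
    have "(\<integral>\<^sup>+\<theta>. ennreal (\<phi> \<theta>) * (\<integral>\<^sup>+w. indicator (ball 0 1) w * (G (sgn w) * ennreal (1 / norm w)) *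
         ennreal (1 / norm (w - \<theta>) ^ (?n - 1)) \<partial>lborel) \<partial>surface_measure) =
        (\<integral>\<^sup>+\<theta>. \<integral>\<^sup>+w. h w \<theta> \<partial>lborel \<partial>surface_measure)"
      unfolding h_def by (intro nn_integral_cong nn_integral_cmult[symmetric]) measurable
    also have "\<dots> = (\<integral>\<^sup>+w. \<integral>\<^sup>+\<theta>. h w \<theta> \<partial>surface_measure \<partial>lborel)"
      by (rule surface_lborel.Fubini'[symmetric]) measurable
    also have "\<dots> = (\<integral>\<^sup>+\<rho>. \<integral>\<^sup>+\<omega>. \<integral>\<^sup>+\<theta>. h (\<rho> *\<^sub>R \<omega>) \<theta> \<partial>surface_measure \<partial>surface_measure \<partial>radial_measure ?n)"
      by (rule nn_integral_polar) measurable
    also have "\<dots> = (\<integral>\<^sup>+\<omega>. \<integral>\<^sup>+\<rho>. \<integral>\<^sup>+\<theta>. h (\<rho> *\<^sub>R \<omega>) \<theta> \<partial>surface_measure \<partial>radial_measure ?n \<partial>surface_measure)"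
      by (rule polar.Fubini'[symmetric]) measurable
    also have "\<dots> \<le> (\<integral>\<^sup>+\<omega>. G \<omega> * K \<partial>surface_measure)"
    proof (rule nn_integral_mono_AE)
      show "AE \<omega> in surface_measure. (\<integral>\<^sup>+\<rho>. \<integral>\<^sup>+\<theta>. h (\<rho> *\<^sub>R \<omega>) \<theta> \<partial>surface_measure \<partial>radial_measure ?n) \<le> G \<omega> * K"
        using AE_surface_measure
      proof eventually_elim
        case (elim \<omega>)
        have hk: "h (\<rho> *\<^sub>R \<omega>) \<theta> = G \<omega> * k \<omega> (\<rho> *\<^sub>R \<theta>)" if "0 < \<rho>" "norm \<theta> = 1" for \<rho> \<theta>
        proof -
          have sgn: "sgn (\<rho> *\<^sub>R \<omega>) = \<omega>" "sgn (\<rho> *\<^sub>R \<theta>) = \<theta>"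
            using that elim by (simp_all add: sgn_scaleR) (simp_all add: sgn_div_norm)
          have ind: "indicator (ball 0 1) (\<rho> *\<^sub>R \<omega>) = (indicator (ball 0 1) (\<rho> *\<^sub>R \<theta>) :: ennreal)"
            using that elim by (simp split: split_indicator)
          have "ennreal (\<phi> \<theta>) * ennreal (1 / \<rho>) * ennreal (1 / norm (\<rho> *\<^sub>R \<omega> - \<theta>) ^ (?n - 1)) =
              ennreal (\<phi> \<theta> / \<rho> * (1 / norm (\<rho> *\<^sub>R \<theta> - \<omega>) ^ (?n - 1)))"
            using that elim nonneg[of \<theta>]
            by (simp add: norm_scaleR_diff_swap[of \<theta> \<omega>] ennreal_mult'[symmetric])
          then show ?thesis
            unfolding h_def k_def sgn ind using that elim by (simp add: mult_ac split: split_indicator)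
        qed
        have "(\<integral>\<^sup>+\<rho>. \<integral>\<^sup>+\<theta>. h (\<rho> *\<^sub>R \<omega>) \<theta> \<partial>surface_measure \<partial>radial_measure ?n) =
            (\<integral>\<^sup>+\<rho>. G \<omega> * (\<integral>\<^sup>+\<theta>. k \<omega> (\<rho> *\<^sub>R \<theta>) \<partial>surface_measure) \<partial>radial_measure ?n)"
        proof (rule nn_integral_cong_AE)
          show "AE \<rho> in radial_measure ?n. (\<integral>\<^sup>+\<theta>. h (\<rho> *\<^sub>R \<omega>) \<theta> \<partial>surface_measure) =
              G \<omega> * (\<integral>\<^sup>+\<theta>. k \<omega> (\<rho> *\<^sub>R \<theta>) \<partial>surface_measure)"
            using AE_radial_measure
          proof eventually_elim
            case pos: (elim \<rho>)
            have "(\<integral>\<^sup>+\<theta>. h (\<rho> *\<^sub>R \<omega>) \<theta> \<partial>surface_measure) = (\<integral>\<^sup>+\<theta>. G \<omega> * k \<omega> (\<rho> *\<^sub>R \<theta>) \<partial>surface_measure)"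
              using AE_surface_measure pos by (intro nn_integral_cong_AE) (auto elim!: eventually_mono intro: hk)
            then show ?case by (simp add: nn_integral_cmult)
          qed
        qed
        also have "\<dots> = G \<omega> * (\<integral>\<^sup>+\<rho>. \<integral>\<^sup>+\<theta>. k \<omega> (\<rho> *\<^sub>R \<theta>) \<partial>surface_measure \<partial>radial_measure ?n)"
          by (rule nn_integral_cmult) measurable
        also have "(\<integral>\<^sup>+\<rho>. \<integral>\<^sup>+\<theta>. k \<omega> (\<rho> *\<^sub>R \<theta>) \<partial>surface_measure \<partial>radial_measure ?n) = (\<integral>\<^sup>+y. k \<omega> y \<partial>lborel)"
          by (rule nn_integral_polar[symmetric]) measurable
        also have "\<dots> \<le> K"
          unfolding k_def using nonneg weak elim by (intro kernel) auto
        finally show ?case by (simp add: mult_left_mono)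
      qed
    qed
    also have "\<dots> = K * (\<integral>\<^sup>+\<omega>. G \<omega> \<partial>surface_measure)"
      by (subst nn_integral_multc) (auto simp: mult.commute)
    finally show ?thesis .
  qed
  show thesis
    by (rule that[OF K]) (rule bound)
qed

text \<open>
  The normalised hypothesis on the level sets says that \<open>\<Omega>\<close> has weak \<open>L\<^sup>n\<close> norm at most one.
  Here \<open>b\<close> is the volume of the unit ball and \<open>m\<close> the integral of \<open>U\<close> over it: since
  \<open>\<Omega>\<close> has mean zero, \<open>b f(x - r\<theta>)\<close> can be replaced by \<open>b f(x - r\<theta>) - m\<close>, which the
  Poincare inequality estimates.
\<close>

lemma sphere_integral_le:
  assumes dim: "2 \<le> DIM('a::euclidean_space)"
  obtains C :: ennreal where "C < top"
    and "\<And>(\<Omega> :: 'a \<Rightarrow> complex) (f :: 'a \<Rightarrow> complex) f' g r x.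
      \<Omega> \<in> borel_measurable borel \<Longrightarrow>
      (\<And>t. 0 < t \<Longrightarrow> measure surface_measure {\<theta>. t < norm (\<Omega> \<theta>)} \<le> t powr (- real DIM('a))) \<Longrightarrow>
      (\<integral>\<theta>. \<Omega> \<theta> \<partial>surface_measure) = 0 \<Longrightarrow>
      (\<And>y. (f has_derivative f' y) (at y)) \<Longrightarrow> (\<And>y v. norm (f' y v) \<le> g y * norm v) \<Longrightarrow>
      continuous_on UNIV g \<Longrightarrow> 0 \<le> r \<Longrightarrow>
      ennreal (norm (\<integral>\<theta>. \<Omega> \<theta> * f (x - r *\<^sub>R \<theta>) \<partial>surface_measure)) \<le>
        C * (\<integral>\<^sup>+\<omega>. ennreal (r * g (x - r *\<^sub>R \<omega>)) \<partial>surface_measure)"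
proof -
  let ?n = "DIM('a)"
  let ?B = "ball (0::'a) 1"
  obtain K :: ennreal where K: "K < top"
    and pairing: "\<And>(\<phi> :: 'a \<Rightarrow> real) G. \<phi> \<in> borel_measurable borel \<Longrightarrow> G \<in> borel_measurable borel \<Longrightarrow> (\<And>\<theta>. 0 \<le> \<phi> \<theta>) \<Longrightarrow>
      (\<And>t. 0 < t \<Longrightarrow> measure surface_measure {\<theta>. t < \<phi> \<theta>} \<le> t powr (- real ?n)) \<Longrightarrow>
      (\<integral>\<^sup>+\<theta>. ennreal (\<phi> \<theta>) * (\<integral>\<^sup>+w. indicator ?B w * (G (sgn w) * ennreal (1 / norm w)) *
         ennreal (1 / norm (w - \<theta>) ^ (?n - 1)) \<partial>lborel) \<partial>surface_measure)
      \<le> K * (\<integral>\<^sup>+\<omega>. G \<omega> \<partial>surface_measure)"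
    by (rule sphere_pairing_le[OF dim], rule that, assumption) blast
  define b where "b = measure lborel ?B"
  have b: "0 < b" unfolding b_def using content_ball_pos[of 1 "0::'a"] by simp
  define C where "C = ennreal (1 / b) * (ennreal (2 ^ ?n / ?n) * (K * 2))"
  have fin: "C < top"
    using K by (simp add: C_def ennreal_mult_less_top)
  have bound: "ennreal (norm (\<integral>\<theta>. \<Omega> \<theta> * f (x - r *\<^sub>R \<theta>) \<partial>surface_measure)) \<le>
        C * (\<integral>\<^sup>+\<omega>. ennreal (r * g (x - r *\<^sub>R \<omega>)) \<partial>surface_measure)"
    if [measurable]: "\<Omega> \<in> borel_measurable borel"
      and weak: "\<And>t. 0 < t \<Longrightarrow> measure surface_measure {\<theta>. t < norm (\<Omega> \<theta>)} \<le> t powr (- real ?n)"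
      and mean: "(\<integral>\<theta>. \<Omega> \<theta> \<partial>surface_measure) = 0"
      and f': "\<And>y. (f has_derivative f' y) (at y)" and f'_le: "\<And>y v. norm (f' y v) \<le> g y * norm v"
      and g: "continuous_on UNIV g" and r: "0 \<le> r"
    for \<Omega> f :: "'a \<Rightarrow> complex" and f' g r x
  proof -
    have g0: "0 \<le> g y" for y
    proof -
      obtain i :: 'a where "i \<in> Basis" using nonempty_Basis by blast
      then show ?thesis
        using order_trans[OF norm_ge_zero f'_le[of y i]] by simp
    qed
    have f: "continuous_on UNIV f"
      using f' by (meson continuous_at_imp_continuous_on has_derivative_continuous)
    have [measurable]: "f \<in> borel_measurable borel" "g \<in> borel_measurable borel"
      using f g by (auto intro: borel_measurable_continuous_onI)
    have "bounded (f ` cball x r)"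
      by (intro compact_imp_bounded compact_continuous_image continuous_on_subset[OF f]) auto
    then obtain M where M: "\<And>y. y \<in> cball x r \<Longrightarrow> norm (f y) \<le> M"
      by (auto simp: bounded_iff simp del: mem_cball)
    have fM: "norm (f (x - r *\<^sub>R \<theta>)) \<le> M" if "norm \<theta> \<le> 1" for \<theta>
      using that r by (intro M) (auto simp: dist_norm mult_left_le)
    have \<Omega>: "integrable surface_measure \<Omega>"
    proof (rule integrableI_bounded)
      have "(\<integral>\<^sup>+\<theta>. ennreal (norm (\<Omega> \<theta>)) \<partial>surface_measure) = (\<integral>\<^sup>+\<theta>. ennreal (norm (\<Omega> \<theta>) powr 1) \<partial>surface_measure)"
        by simp
      also have "\<dots> \<le> emeasure (surface_measure :: 'a measure) UNIV + ennreal (2 powr 1 / (1 - 2 powr (1 - real ?n)))"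
        using surface.nn_integral_powr_weak_bound[of "\<lambda>\<theta>. norm (\<Omega> \<theta>)" 1 ?n] dim weak by simp
      also have "\<dots> < \<infinity>" by simp
      finally show "(\<integral>\<^sup>+\<theta>. ennreal (norm (\<Omega> \<theta>)) \<partial>surface_measure) < \<infinity>" .
    qed simp
    have \<Omega>f: "integrable surface_measure (\<lambda>\<theta>. \<Omega> \<theta> * f (x - r *\<^sub>R \<theta>))"
    proof (rule Bochner_Integration.integrable_bound)
      show "integrable surface_measure (\<lambda>\<theta>. of_real M * \<Omega> \<theta>)" using \<Omega> by simp
      show "AE \<theta> in surface_measure. norm (\<Omega> \<theta> * f (x - r *\<^sub>R \<theta>)) \<le> norm (of_real M * \<Omega> \<theta>)"
        using AE_surface_measure
      proof eventually_elim
        case (elim \<theta>)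
        then have "norm (f (x - r *\<^sub>R \<theta>)) \<le> \<bar>M\<bar>" using fM[of \<theta>] by simp
        then show ?case
          by (simp add: norm_mult mult.commute[of _ "norm (f _)"] mult_right_mono)
      qed
    qed simp
    define U where "U z = f (x - r *\<^sub>R sgn z)" for z
    define m where "m = (LINT z:?B|lborel. U z)"
    have [measurable]: "U \<in> borel_measurable borel" unfolding U_def by measurable
    have Bfin: "emeasure lborel ?B < \<infinity>" by (rule emeasure_lborel_ball_finite)
    have U: "set_integrable lborel ?B U"
      unfolding set_integrable_def
    proof (rule integrableI_bounded_set_indicator[where B=M])
      show "AE z in lborel. z \<in> ?B \<longrightarrow> norm (U z) \<le> M"
        unfolding U_def by (intro AE_I2 impI fM) (simp add: norm_sgn)
    qed (use Bfin in auto)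
    have const: "set_integrable lborel ?B (\<lambda>z. a)" for a :: complex
      unfolding set_integrable_def using Bfin by (intro integrableI_bounded_set_indicator[where B="norm a"]) auto
    have dev: "ennreal (norm (of_real b * f (x - r *\<^sub>R \<theta>) - m)) \<le>
        (\<integral>\<^sup>+z. indicator ?B z * ennreal (norm (U z - f (x - r *\<^sub>R \<theta>))) \<partial>lborel)" for \<theta>
    proof -
      have "of_real b * f (x - r *\<^sub>R \<theta>) - m = (LINT z:?B|lborel. f (x - r *\<^sub>R \<theta>)) - m"
        using Bfin unfolding set_lebesgue_integral_def b_def
        by (subst integral_scaleR_left) (auto simp: scaleR_conv_of_real)
      also have "\<dots> = (LINT z:?B|lborel. f (x - r *\<^sub>R \<theta>) - U z)"
        unfolding m_def by (rule set_integral_diff(2)[symmetric]) (rule const U)+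
      finally have "norm (of_real b * f (x - r *\<^sub>R \<theta>) - m) = norm (LINT z:?B|lborel. f (x - r *\<^sub>R \<theta>) - U z)"
        by simp
      also have "ennreal \<dots> \<le> (\<integral>\<^sup>+z. ennreal (norm (indicator ?B z *\<^sub>R (f (x - r *\<^sub>R \<theta>) - U z))) \<partial>lborel)"
        unfolding set_lebesgue_integral_def
        using set_integral_diff(1)[OF const U] by (intro integral_norm_bound_ennreal) (simp add: set_integrable_def)
      also have "\<dots> = (\<integral>\<^sup>+z. indicator ?B z * ennreal (norm (U z - f (x - r *\<^sub>R \<theta>))) \<partial>lborel)"
        by (intro nn_integral_cong) (simp add: norm_minus_commute split: split_indicator)
      finally show ?thesis .
    qed
    define G where "G \<omega> = ennreal (2 * r * g (x - r *\<^sub>R \<omega>))" for \<omega>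
    have [measurable]: "G \<in> borel_measurable borel" unfolding G_def by measurable
    have "of_real b * (\<integral>\<theta>. \<Omega> \<theta> * f (x - r *\<^sub>R \<theta>) \<partial>surface_measure) =
        (\<integral>\<theta>. of_real b * (\<Omega> \<theta> * f (x - r *\<^sub>R \<theta>)) \<partial>surface_measure) - (\<integral>\<theta>. m * \<Omega> \<theta> \<partial>surface_measure)"
      using mean by simp
    also have "\<dots> = (\<integral>\<theta>. \<Omega> \<theta> * (of_real b * f (x - r *\<^sub>R \<theta>) - m) \<partial>surface_measure)"
      using \<Omega> \<Omega>f by (subst Bochner_Integration.integral_diff[symmetric]) (auto simp: algebra_simps)
    finally have "ennreal (b * norm (\<integral>\<theta>. \<Omega> \<theta> * f (x - r *\<^sub>R \<theta>) \<partial>surface_measure)) =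
        ennreal (norm (\<integral>\<theta>. \<Omega> \<theta> * (of_real b * f (x - r *\<^sub>R \<theta>) - m) \<partial>surface_measure))"
      using b by (metis abs_of_pos norm_mult norm_of_real)
    also have "\<dots> \<le> (\<integral>\<^sup>+\<theta>. ennreal (norm (\<Omega> \<theta> * (of_real b * f (x - r *\<^sub>R \<theta>) - m))) \<partial>surface_measure)"
    proof (rule integral_norm_bound_ennreal)
      have "integrable surface_measure (\<lambda>\<theta>. of_real b * (\<Omega> \<theta> * f (x - r *\<^sub>R \<theta>)) - m * \<Omega> \<theta>)"
        using \<Omega> \<Omega>f by auto
      then show "integrable surface_measure (\<lambda>\<theta>. \<Omega> \<theta> * (of_real b * f (x - r *\<^sub>R \<theta>) - m))"
        by (simp add: algebra_simps)
    qed
    also have "\<dots> \<le> (\<integral>\<^sup>+\<theta>. ennreal (2 ^ ?n / ?n) * (ennreal (norm (\<Omega> \<theta>)) *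
        (\<integral>\<^sup>+w. indicator ?B w * (G (sgn w) * ennreal (1 / norm w)) *
         ennreal (1 / norm (w - \<theta>) ^ (?n - 1)) \<partial>lborel)) \<partial>surface_measure)"
    proof (rule nn_integral_mono_AE)
      show "AE \<theta> in surface_measure. ennreal (norm (\<Omega> \<theta> * (of_real b * f (x - r *\<^sub>R \<theta>) - m))) \<le>
        ennreal (2 ^ ?n / ?n) * (ennreal (norm (\<Omega> \<theta>)) *
        (\<integral>\<^sup>+w. indicator ?B w * (G (sgn w) * ennreal (1 / norm w)) *
         ennreal (1 / norm (w - \<theta>) ^ (?n - 1)) \<partial>lborel))"
        using AE_surface_measure
      proof eventually_elim
        case (elim \<theta>)
        have "ennreal (norm (of_real b * f (x - r *\<^sub>R \<theta>) - m)) \<le>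
          ennreal (2 ^ ?n / ?n) * (\<integral>\<^sup>+w. indicator ?B w * ennreal (2 * r * g (x - r *\<^sub>R sgn w) / norm w) *
            ennreal (1 / norm (w - \<theta>) ^ (?n - 1)) \<partial>lborel)"
          using order_trans[OF dev[of \<theta>, unfolded U_def] spherical_poincare[OF dim f' f'_le g r elim, of x]] .
        also have "(\<lambda>w. ennreal (2 * r * g (x - r *\<^sub>R sgn w) / norm w)) = (\<lambda>w. G (sgn w) * ennreal (1 / norm w))"
          unfolding G_def by (subst ennreal_mult''[symmetric]) auto
        finally show ?case
          by (simp add: norm_mult ennreal_mult mult_left_mono mult.left_commute)
      qed
    qed
    also have "\<dots> = ennreal (2 ^ ?n / ?n) * (\<integral>\<^sup>+\<theta>. (ennreal (norm (\<Omega> \<theta>)) *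
        (\<integral>\<^sup>+w. indicator ?B w * (G (sgn w) * ennreal (1 / norm w)) *
         ennreal (1 / norm (w - \<theta>) ^ (?n - 1)) \<partial>lborel)) \<partial>surface_measure)"
      by (rule nn_integral_cmult) measurable
    also have "\<dots> \<le> ennreal (2 ^ ?n / ?n) * (K * (\<integral>\<^sup>+\<omega>. G \<omega> \<partial>surface_measure))"
      using weak by (intro mult_left_mono pairing) auto
    also have "(\<integral>\<^sup>+\<omega>. G \<omega> \<partial>surface_measure) = 2 * (\<integral>\<^sup>+\<omega>. ennreal (r * g (x - r *\<^sub>R \<omega>)) \<partial>surface_measure)"
      unfolding G_def using r g0
      by (subst nn_integral_cmult[symmetric]) (auto simp: ennreal_mult' mult.assoc)
    finally have "ennreal (1 / b) * ennreal (b * norm (\<integral>\<theta>. \<Omega> \<theta> * f (x - r *\<^sub>R \<theta>) \<partial>surface_measure)) \<le>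
        ennreal (1 / b) * (ennreal (2 ^ ?n / ?n) * (K * (2 * (\<integral>\<^sup>+\<omega>. ennreal (r * g (x - r *\<^sub>R \<omega>)) \<partial>surface_measure))))"
      by (rule mult_left_mono) simp
    then show ?thesis
      using b by (simp add: C_def ennreal_mult'[symmetric] mult.assoc)
  qed
  show thesis
    by (rule that[OF fin]) (rule bound)
qed

section \<open>Summation over the radii\<close>

text \<open>
  Integration of \<open>sphere_integral_le\<close> over the radii: the kernel contributes \<open>r\<^sup>-\<^sup>n\<close> and the
  estimate on the sphere a factor \<open>r\<close>, which leaves the Riesz kernel \<open>r\<^sup>1\<^sup>-\<^sup>n\<close>.
\<close>

lemma truncated_integral_le:
  assumes dim: "2 \<le> DIM('a::euclidean_space)"
  obtains C :: ennreal where "C < top"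
    and "\<And>(\<Omega> :: 'a \<Rightarrow> complex) (f :: 'a \<Rightarrow> complex) f' g t x.
      \<Omega> \<in> borel_measurable borel \<Longrightarrow>
      (\<And>t. 0 < t \<Longrightarrow> measure surface_measure {\<theta>. t < norm (\<Omega> \<theta>)} \<le> t powr (- real DIM('a))) \<Longrightarrow>
      (\<integral>\<theta>. \<Omega> \<theta> \<partial>surface_measure) = 0 \<Longrightarrow>
      (\<And>y. (f has_derivative f' y) (at y)) \<Longrightarrow> (\<And>y v. norm (f' y v) \<le> g y * norm v) \<Longrightarrow>
      continuous_on UNIV g \<Longrightarrow> 0 < t \<Longrightarrow>
      ennreal (norm (LINT y:{y. t < norm y}|lborel. \<Omega> (sgn y) / of_real (norm y ^ DIM('a)) * f (x - y))) \<le>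
        C * (\<integral>\<^sup>+y. ennreal (g y / norm (x - y) ^ (DIM('a) - 1)) \<partial>lborel)"
proof -
  let ?n = "DIM('a)"
  obtain C :: ennreal where C: "C < top"
    and sphere: "\<And>(\<Omega> :: 'a \<Rightarrow> complex) (f :: 'a \<Rightarrow> complex) f' g r x.
      \<Omega> \<in> borel_measurable borel \<Longrightarrow>
      (\<And>t. 0 < t \<Longrightarrow> measure surface_measure {\<theta>. t < norm (\<Omega> \<theta>)} \<le> t powr (- real DIM('a))) \<Longrightarrow>
      (\<integral>\<theta>. \<Omega> \<theta> \<partial>surface_measure) = 0 \<Longrightarrow>
      (\<And>y. (f has_derivative f' y) (at y)) \<Longrightarrow> (\<And>y v. norm (f' y v) \<le> g y * norm v) \<Longrightarrow>
      continuous_on UNIV g \<Longrightarrow> 0 \<le> r \<Longrightarrow>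
      ennreal (norm (\<integral>\<theta>. \<Omega> \<theta> * f (x - r *\<^sub>R \<theta>) \<partial>surface_measure)) \<le>
        C * (\<integral>\<^sup>+\<omega>. ennreal (r * g (x - r *\<^sub>R \<omega>)) \<partial>surface_measure)"
    by (rule sphere_integral_le[OF dim], rule that, assumption) blast
  have bound: "ennreal (norm (LINT y:{y. t < norm y}|lborel. \<Omega> (sgn y) / of_real (norm y ^ ?n) * f (x - y))) \<le>
        C * (\<integral>\<^sup>+y. ennreal (g y / norm (x - y) ^ (?n - 1)) \<partial>lborel)"
    if [measurable]: "\<Omega> \<in> borel_measurable borel"
      and weak: "\<And>t. 0 < t \<Longrightarrow> measure surface_measure {\<theta>. t < norm (\<Omega> \<theta>)} \<le> t powr (- real ?n)"
      and mean: "(\<integral>\<theta>. \<Omega> \<theta> \<partial>surface_measure) = 0"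
      and f': "\<And>y. (f has_derivative f' y) (at y)" and f'_le: "\<And>y v. norm (f' y v) \<le> g y * norm v"
      and g: "continuous_on UNIV g" and t: "0 < t"
    for \<Omega> f :: "'a \<Rightarrow> complex" and f' g t x
  proof -
    define h where "h y = indicator {y. t < norm y} y *\<^sub>R (\<Omega> (sgn y) / of_real (norm y ^ ?n) * f (x - y))" for y
    have g0: "0 \<le> g y" for y
    proof -
      obtain i :: 'a where "i \<in> Basis" using nonempty_Basis by blast
      then show ?thesis
        using order_trans[OF norm_ge_zero f'_le[of y i]] by simp
    qed
    have "continuous_on UNIV f"
      using f' by (meson continuous_at_imp_continuous_on has_derivative_continuous)
    then have [measurable]: "f \<in> borel_measurable borel" "g \<in> borel_measurable borel"
      using g by (auto intro: borel_measurable_continuous_onI)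
    have h [measurable]: "h \<in> borel_measurable borel"
      unfolding h_def by measurable
    have slice: "ennreal (norm (\<integral>\<theta>. h (r *\<^sub>R \<theta>) \<partial>surface_measure)) \<le>
        C * (\<integral>\<^sup>+\<omega>. ennreal (g (x - r *\<^sub>R \<omega>) / norm (r *\<^sub>R \<omega>) ^ (?n - 1)) \<partial>surface_measure)" if r: "0 < r" for r
    proof (cases "t < r")
      case True
      have "(\<integral>\<theta>. h (r *\<^sub>R \<theta>) \<partial>surface_measure) =
          (\<integral>\<theta>. of_real (1 / r ^ ?n) * (\<Omega> \<theta> * f (x - r *\<^sub>R \<theta>)) \<partial>surface_measure)"
      proof (rule integral_cong_AE)
        show "AE \<theta> in surface_measure. h (r *\<^sub>R \<theta>) = of_real (1 / r ^ ?n) * (\<Omega> \<theta> * f (x - r *\<^sub>R \<theta>))"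
          using AE_surface_measure
        proof eventually_elim
          case (elim \<theta>)
          then have "sgn (r *\<^sub>R \<theta>) = \<theta>" using r by (simp add: sgn_scaleR) (simp add: sgn_div_norm)
          with elim r True show ?case by (simp add: h_def)
        qed
      qed measurable
      also have "\<dots> = of_real (1 / r ^ ?n) * (\<integral>\<theta>. \<Omega> \<theta> * f (x - r *\<^sub>R \<theta>) \<partial>surface_measure)"
        by (rule integral_mult_right_zero)
      finally have "ennreal (norm (\<integral>\<theta>. h (r *\<^sub>R \<theta>) \<partial>surface_measure)) =
          ennreal (1 / r ^ ?n) * ennreal (norm (\<integral>\<theta>. \<Omega> \<theta> * f (x - r *\<^sub>R \<theta>) \<partial>surface_measure))"
        using r by (simp add: norm_mult norm_divide norm_power ennreal_mult'[symmetric])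
      also have "\<dots> \<le> ennreal (1 / r ^ ?n) * (C * (\<integral>\<^sup>+\<omega>. ennreal (r * g (x - r *\<^sub>R \<omega>)) \<partial>surface_measure))"
        using r weak mean f' f'_le g by (intro mult_left_mono sphere) auto
      also have "\<dots> = C * (\<integral>\<^sup>+\<omega>. ennreal (1 / r ^ ?n) * ennreal (r * g (x - r *\<^sub>R \<omega>)) \<partial>surface_measure)"
        by (subst nn_integral_cmult) (auto simp: mult_ac)
      also have "(\<integral>\<^sup>+\<omega>. ennreal (1 / r ^ ?n) * ennreal (r * g (x - r *\<^sub>R \<omega>)) \<partial>surface_measure) =
          (\<integral>\<^sup>+\<omega>. ennreal (g (x - r *\<^sub>R \<omega>) / norm (r *\<^sub>R \<omega>) ^ (?n - 1)) \<partial>surface_measure)"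
      proof (rule nn_integral_cong_AE)
        show "AE \<omega> in surface_measure. ennreal (1 / r ^ ?n) * ennreal (r * g (x - r *\<^sub>R \<omega>)) =
          ennreal (g (x - r *\<^sub>R \<omega>) / norm (r *\<^sub>R \<omega>) ^ (?n - 1))"
          using AE_surface_measure
        proof eventually_elim
          case (elim \<omega>)
          have "r ^ ?n = r ^ (?n - 1) * r"
            using power_minus_mult[of ?n r] by simp
          with elim r g0 show ?case by (simp add: ennreal_mult'[symmetric] field_simps)
        qed
      qed
      finally show ?thesis .
    next
      case False
      have "(\<integral>\<theta>. h (r *\<^sub>R \<theta>) \<partial>surface_measure) = (\<integral>\<theta>. 0 \<partial>(surface_measure :: 'a measure))"
        using AE_surface_measure r False
        by (intro integral_cong_AE) (auto elim!: eventually_mono simp: h_def)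
      then show ?thesis by simp
    qed
    have "ennreal (norm (\<integral>y. h y \<partial>lborel)) \<le> C * (\<integral>\<^sup>+y. ennreal (g (x - y) / norm y ^ (?n - 1)) \<partial>lborel)"
    \<comment> \<open>If the integrand is not integrable, its Bochner integral is zero by convention.\<close>
    proof (cases "integrable lborel h")
      case True
      note polar = integral_polar[OF True]
      have "ennreal (norm (\<integral>y. h y \<partial>lborel)) \<le>
          (\<integral>\<^sup>+r. ennreal (norm (\<integral>\<theta>. h (r *\<^sub>R \<theta>) \<partial>surface_measure)) \<partial>radial_measure ?n)"
        unfolding polar(2) by (rule integral_norm_bound_ennreal) (rule polar(1))
      also have "\<dots> \<le> (\<integral>\<^sup>+r. C * (\<integral>\<^sup>+\<omega>. ennreal (g (x - r *\<^sub>R \<omega>) / norm (r *\<^sub>R \<omega>) ^ (?n - 1)) \<partial>surface_measure)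
          \<partial>radial_measure ?n)"
        by (intro nn_integral_mono_AE eventually_mono[OF AE_radial_measure]) (rule slice)
      also have "\<dots> = C * (\<integral>\<^sup>+r. \<integral>\<^sup>+\<omega>. ennreal (g (x - r *\<^sub>R \<omega>) / norm (r *\<^sub>R \<omega>) ^ (?n - 1)) \<partial>surface_measure
          \<partial>radial_measure ?n)"
        by (rule nn_integral_cmult) measurable
      also have "(\<integral>\<^sup>+r. \<integral>\<^sup>+\<omega>. ennreal (g (x - r *\<^sub>R \<omega>) / norm (r *\<^sub>R \<omega>) ^ (?n - 1)) \<partial>surface_measure
          \<partial>radial_measure ?n) = (\<integral>\<^sup>+y. ennreal (g (x - y) / norm y ^ (?n - 1)) \<partial>lborel)"
        by (rule nn_integral_polar[symmetric]) measurable
      finally show ?thesis .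
    qed (simp add: not_integrable_integral_eq)
    also have "(\<integral>\<^sup>+y. ennreal (g (x - y) / norm y ^ (?n - 1)) \<partial>lborel) =
        ennreal (\<bar>-1\<bar> ^ ?n) * (\<integral>\<^sup>+y. ennreal (g (x - (x + (-1) *\<^sub>R y)) / norm (x + (-1) *\<^sub>R y) ^ (?n - 1)) \<partial>lborel)"
      by (rule nn_integral_affine) auto
    also have "\<dots> = (\<integral>\<^sup>+y. ennreal (g y / norm (x - y) ^ (?n - 1)) \<partial>lborel)"
      by simp
    finally show ?thesis
      unfolding set_lebesgue_integral_def h_def .
  qed
  show thesis
    by (rule that[OF C]) (rule bound)
qed

section \<open>The surface measure of the sphere and Borel representatives\<close>

lemma sets_sphere_borel_measure:
  "sets (sphere_borel_measure :: (real ^ 'n::finite) measure) = sets (restrict_space borel (sphere 0 1))"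
  by (simp add: sphere_borel_measure_def)

lemma space_sphere_borel_measure:
  "space (sphere_borel_measure :: (real ^ 'n::finite) measure) = sphere 0 1"
  by (simp add: sphere_borel_measure_def space_scale_measure space_restrict_space)

lemma measurable_ident_sphere_borel_measure:
  "(\<lambda>x. x) \<in> sphere_borel_measure \<rightarrow>\<^sub>M (borel :: (real ^ 'n::finite) measure)"
  unfolding measurable_cong_sets[OF sets_sphere_borel_measure refl]
  by (rule measurable_restrict_space1) simp

lemma distr_sphere_borel_measure:
  "distr sphere_borel_measure borel (\<lambda>x. x) = (surface_measure :: (real ^ 'n::finite) measure)"
proof (rule measure_eqI)
  fix A :: "(real ^ 'n) set" assume "A \<in> sets (distr sphere_borel_measure borel (\<lambda>x. x))"
  then have [measurable]: "A \<in> sets borel" by simp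
  have B: "A \<inter> sphere 0 1 \<in> sets sphere_borel_measure"
    by (auto simp: sets_sphere_borel_measure sets_restrict_space)
  have "emeasure (distr sphere_borel_measure borel (\<lambda>x. x)) A = emeasure sphere_borel_measure (A \<inter> sphere 0 1)"
    using measurable_ident_sphere_borel_measure by (subst emeasure_distr) (auto simp: space_sphere_borel_measure)
  also have "\<dots> = emeasure sphere_measure (A \<inter> sphere 0 1)"
    using B by (simp add: sphere_measure_def)
  also have "\<dots> = of_nat CARD('n) * emeasure lborel {x. x \<noteq> 0 \<and> norm x < 1 \<and> sgn x \<in> A \<inter> sphere 0 1}"
    by (rule emeasure_sphere_measure) auto
  also have "emeasure lborel {x. x \<noteq> 0 \<and> norm x < 1 \<and> sgn x \<in> A \<inter> sphere 0 1} =
      emeasure lborel {x. norm x < 1 \<and> sgn x \<in> A}"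
  proof (rule emeasure_eq_AE)
    show "AE x in lborel. x \<in> {x. x \<noteq> 0 \<and> norm x < 1 \<and> sgn x \<in> A \<inter> sphere 0 1} \<longleftrightarrow>
        x \<in> {x. norm x < 1 \<and> sgn x \<in> A}"
      using AE_lborel_singleton[of 0] by eventually_elim (simp add: norm_sgn)
    have [measurable]: "sphere 0 1 \<in> sets (borel :: (real ^ 'n) measure)" by simp
    show "{x. x \<noteq> 0 \<and> norm x < 1 \<and> sgn x \<in> A \<inter> sphere 0 1} \<in> sets lborel" by measurable
  qed measurable
  also have "of_nat CARD('n) * \<dots> = emeasure surface_measure A"
    by (subst emeasure_surface_measure) auto
  finally show "emeasure (distr sphere_borel_measure borel (\<lambda>x. x)) A = emeasure surface_measure A" .
qed simp

text \<open>
  The completed measure admits functions that are not Borel; the arguments above need Borel ones, as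
  Fubini's theorem does, and a modification on a null set provides them.
\<close>

lemma sphere_measurable_borel_representative:
  fixes \<Omega> :: "real ^ 'n::finite \<Rightarrow> complex"
  assumes \<Omega>: "\<Omega> \<in> borel_measurable sphere_measure"
  obtains \<Omega>' where "\<Omega>' \<in> borel_measurable borel" "AE \<theta> in sphere_borel_measure. \<Omega> \<theta> = \<Omega>' \<theta>"
proof -
  let ?S = "sphere 0 1 :: (real ^ 'n) set"
  have *: "\<exists>v'. v' \<in> borel_measurable borel \<and> (AE \<theta> in sphere_borel_measure. v \<theta> = v' \<theta>)"
    if v: "v \<in> borel_measurable sphere_measure" for v :: "real ^ 'n \<Rightarrow> real"
  proof -
    obtain g where g: "g \<in> borel_measurable sphere_borel_measure" "AE \<theta> in sphere_borel_measure. v \<theta> = g \<theta>"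
      using completion_ex_borel_measurable_real[OF v[unfolded sphere_measure_def]] by blast
    have "g \<in> borel_measurable (restrict_space borel ?S)"
      using g(1) by (simp add: measurable_cong_sets[OF sets_sphere_borel_measure refl])
    then have "(\<lambda>\<theta>. indicator ?S \<theta> *\<^sub>R g \<theta>) \<in> borel_measurable borel"
      by (subst (asm) borel_measurable_restrict_space_iff) auto
    moreover have "AE \<theta> in sphere_borel_measure. v \<theta> = indicator ?S \<theta> *\<^sub>R g \<theta>"
      using g(2) AE_space by eventually_elim (simp add: space_sphere_borel_measure)
    ultimately show ?thesis by blast
  qed
  have "(\<lambda>\<theta>. Re (\<Omega> \<theta>)) \<in> borel_measurable sphere_measure" "(\<lambda>\<theta>. Im (\<Omega> \<theta>)) \<in> borel_measurable sphere_measure"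
    using \<Omega> by measurable
  from this[THEN *] obtain u v where uv: "u \<in> borel_measurable borel" "v \<in> borel_measurable borel"
    "AE \<theta> in sphere_borel_measure. Re (\<Omega> \<theta>) = u \<theta>" "AE \<theta> in sphere_borel_measure. Im (\<Omega> \<theta>) = v \<theta>"
    by blast
  show thesis
  proof (rule that)
    show "(\<lambda>\<theta>. Complex (u \<theta>) (v \<theta>)) \<in> borel_measurable borel"
      using uv(1,2) by (simp add: borel_measurable_complex_iff)
    show "AE \<theta> in sphere_borel_measure. \<Omega> \<theta> = Complex (u \<theta>) (v \<theta>)"
      using uv(3,4) by eventually_elim (simp add: complex_eq_iff)
  qed
qed

text \<open>
  The cone over a null set of directions is a null set.
\<close>

lemma AE_lborel_sgn:
  fixes P :: "real ^ 'n::finite \<Rightarrow> bool"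
  assumes "AE \<theta> in sphere_borel_measure. P \<theta>"
  shows "AE y in lborel. y \<noteq> 0 \<longrightarrow> P (sgn y)"
proof -
  obtain N where N: "N \<in> null_sets sphere_borel_measure" "{\<theta> \<in> sphere 0 1. \<not> P \<theta>} \<subseteq> N"
    using assms by (auto simp: eventually_ae_filter space_sphere_borel_measure)
  have sphere: "N \<subseteq> sphere 0 1"
    using N(1) sets.sets_into_space[of N sphere_borel_measure] by (auto simp: space_sphere_borel_measure)
  have [measurable]: "N \<in> sets borel"
    using N(1) by (auto simp: null_sets_def sets_sphere_borel_measure sets_restrict_space)
  have "emeasure surface_measure N = emeasure sphere_borel_measure N"
    unfolding distr_sphere_borel_measure[symmetric] using sphere
    by (subst emeasure_distr) (auto simp: measurable_ident_sphere_borel_measure space_sphere_borel_measure inf.absorb1)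
  then have "emeasure surface_measure N = 0"
    using N(1) by auto
  then have "emeasure lborel {y. sgn y \<in> N} = 0"
    using emeasure_polar_rectangle[of UNIV N] by simp
  moreover have "{y. sgn y \<in> N} \<in> sets lborel" by measurable
  ultimately have "{y. sgn y \<in> N} \<in> null_sets lborel" by (auto simp: null_sets_def)
  then have "AE y in lborel. sgn y \<notin> N"
    using AE_not_in by fastforce
  then show ?thesis
  proof eventually_elim
    case (elim y)
    show ?case
    proof
      assume "y \<noteq> 0"
      then have "sgn y \<in> sphere 0 1" by (simp add: norm_sgn)
      with elim N(2) show "P (sgn y)" by blast
    qed
  qed
qed

section \<open>Test functions and their Riesz potentials\<close>

lemma has_derivative_test_function:
  assumes "test_function f"
  shows "(f has_derivative frechet_derivative f (at y)) (at y)"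
proof -
  have "C_upto (Suc 0) f" using assms by (simp only: test_function_def)
  then have "f differentiable (at y)" by (simp add: differentiable_on_def)
  then show ?thesis by (simp add: frechet_derivative_works)
qed

lemma norm_frechet_derivative_le:
  fixes f :: "real ^ 'n::finite \<Rightarrow> complex"
  assumes "test_function f"
  shows "norm (frechet_derivative f (at y) v) \<le> norm (gradient f y) * norm v"
proof -
  let ?D = "frechet_derivative f (at y)"
  have lin: "linear ?D"
    using has_derivative_test_function[OF assms] by (rule has_derivative_linear)
  have "v = (\<Sum>i\<in>UNIV. (v $ i) *\<^sub>R axis i 1)"
    by (simp add: vec_eq_iff axis_def if_distrib cong: if_cong)
  then have "?D v = ?D (\<Sum>i\<in>UNIV. (v $ i) *\<^sub>R axis i 1)" by simp
  also have "\<dots> = (\<Sum>i\<in>UNIV. (v $ i) *\<^sub>R ?D (axis i 1))"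
    by (simp add: linear_sum[OF lin] linear_cmul[OF lin])
  also have "norm \<dots> \<le> (\<Sum>i\<in>UNIV. \<bar>v $ i\<bar> * \<bar>norm (?D (axis i 1))\<bar>)"
    by (rule order_trans[OF norm_sum]) simp
  also have "\<dots> \<le> L2_set (\<lambda>i. v $ i) UNIV * L2_set (\<lambda>i. norm (?D (axis i 1))) UNIV"
    by (rule L2_set_mult_ineq)
  also have "\<dots> = norm (gradient f y) * norm v"
    by (simp add: norm_vec_def gradient_def L2_set_def mult.commute)
  finally show ?thesis .
qed

lemma continuous_on_gradient:
  assumes "test_function f"
  shows "continuous_on UNIV (gradient f)"
proof -
  have "C_upto (Suc 0) f" using assms by (simp only: test_function_def)
  then show ?thesis
    unfolding gradient_def by (intro continuous_on_vec_lambda) simp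
qed

lemma gradient_eq_0_outside_support:
  assumes "y \<notin> closure {x. f x \<noteq> 0}"
  shows "gradient f y = 0"
proof -
  have "((\<lambda>x. 0) has_derivative (\<lambda>v. 0)) (at y)" by simp
  then have "(f has_derivative (\<lambda>v. 0)) (at y)"
  proof (rule has_derivative_transform_within_open)
    show "open (- closure {x. f x \<noteq> 0})" by auto
    show "y \<in> - closure {x. f x \<noteq> 0}" using assms by simp
    show "0 = f x" if "x \<in> - closure {x. f x \<noteq> 0}" for x
      using that closure_subset[of "{x. f x \<noteq> 0}"] by auto
  qed
  then have "frechet_derivative f (at y) = (\<lambda>v. 0)"
    by (rule frechet_derivative_at[symmetric])
  then show ?thesis by (simp add: gradient_def vec_eq_iff)
qed

text \<open>
  The Riesz potential is defined by a Bochner integral, which would be zero if it diverged.  It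
  converges, because the gradient is bounded with compact support and the Riesz kernel is locally
  integrable.
\<close>

lemma riesz_potential_gradient:
  fixes f :: "real ^ 'n::finite \<Rightarrow> complex"
  assumes dim: "2 \<le> CARD('n)" and f: "test_function f"
  shows "(\<integral>\<^sup>+y. ennreal (norm (gradient f y) / norm (x - y) ^ (CARD('n) - 1)) \<partial>lborel) =
    ennreal (riesz_potential_1 (\<lambda>y. norm (gradient f y)) x)"
proof -
  let ?n = "CARD('n)"
  let ?h = "\<lambda>y. norm (gradient f y) / norm (x - y) ^ (?n - 1)"
  have [measurable]: "gradient f \<in> borel_measurable borel"
    by (rule borel_measurable_continuous_onI[OF continuous_on_gradient[OF f]])
  define K where "K = closure {x. f x \<noteq> 0}"
  have K: "compact K" using f by (simp add: test_function_def K_def)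
  have "bounded (gradient f ` K)"
    by (intro compact_imp_bounded compact_continuous_image K continuous_on_subset[OF continuous_on_gradient[OF f]]) simp
  then obtain M where M: "\<And>y. y \<in> K \<Longrightarrow> norm (gradient f y) \<le> M"
    by (auto simp: bounded_iff)
  obtain R where R: "\<And>y. y \<in> K \<Longrightarrow> norm y < R"
    using compact_imp_bounded[OF K] by (auto simp: bounded_pos_less)
  have "(\<integral>\<^sup>+y. ennreal (?h y) \<partial>lborel) \<le>
      (\<integral>\<^sup>+y. ennreal \<bar>M\<bar> * (indicator (ball 0 R) y * ennreal (norm (y - x) powr - (real ?n - 1))) \<partial>lborel)"
  proof (rule nn_integral_mono)
    fix y
    show "ennreal (?h y) \<le> ennreal \<bar>M\<bar> * (indicator (ball 0 R) y * ennreal (norm (y - x) powr - (real ?n - 1)))"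
    proof (cases "y \<in> K")
      case True
      have powr: "1 / norm (x - y) ^ (?n - 1) = norm (y - x) powr - (real ?n - 1)"
      proof (cases "y = x")
        case False
        then show ?thesis
          using dim powr_realpow[of "norm (y - x)" "?n - 1"]
          unfolding powr_minus by (simp add: of_nat_diff divide_inverse norm_minus_commute)
      qed (use dim in \<open>simp add: power_0_left\<close>)
      have "?h y = norm (gradient f y) * norm (y - x) powr - (real ?n - 1)"
        by (simp only: powr[symmetric] times_divide_eq_right mult_1_right)
      also have "\<dots> \<le> \<bar>M\<bar> * norm (y - x) powr - (real ?n - 1)"
        using M[OF True] by (intro mult_right_mono) auto
      finally have "ennreal (?h y) \<le> ennreal (\<bar>M\<bar> * norm (y - x) powr - (real ?n - 1))"
        by (rule ennreal_leI)
      with R[OF True] show ?thesis by (simp add: ennreal_mult)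
    next
      case False
      then show ?thesis
        using gradient_eq_0_outside_support[of y f] by (simp add: K_def)
    qed
  qed
  also have "\<dots> = ennreal \<bar>M\<bar> * (\<integral>\<^sup>+y. indicator (ball 0 R) y * ennreal (norm (y - x) powr - (real ?n - 1)) \<partial>lborel)"
    by (rule nn_integral_cmult) measurable
  also have "\<dots> \<le> ennreal \<bar>M\<bar> * (\<integral>\<^sup>+y. indicator (ball (0 :: real ^ 'n) (R + norm x)) y * ennreal (norm y powr - (real ?n - 1)) \<partial>lborel)"
    by (intro mult_left_mono nn_integral_norm_diff_powr_le) auto
  also have "\<dots> < \<infinity>"
    using nn_integral_norm_powr_ball_finite[where 'a="real ^ 'n", of "real ?n - 1" "R + norm x"]
    by (simp add: ennreal_mult_less_top)
  finally have fin: "(\<integral>\<^sup>+y. ennreal (?h y) \<partial>lborel) < \<infinity>" .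
  have "integrable lborel ?h"
    using fin by (intro integrableI_bounded) auto
  then have "(\<integral>\<^sup>+y. ennreal (?h y) \<partial>lborel) = ennreal (\<integral>y. ?h y \<partial>lborel)"
    by (intro nn_integral_eq_integral) auto
  also have "(\<integral>y. ?h y \<partial>lborel) = riesz_potential_1 (\<lambda>y. norm (gradient f y)) x"
    unfolding riesz_potential_1_def by (rule integral_completion[symmetric]) measurable
  finally show ?thesis .
qed

section \<open>The maximal operator\<close>

lemma weak_Ln_norm_distribution:
  fixes \<Omega> :: "real ^ 'n::finite \<Rightarrow> complex"
  assumes \<Omega>: "in_weak_Ln \<Omega>" and \<kappa>: "0 < \<kappa>" "weak_Ln_norm \<Omega> \<le> ennreal \<kappa>" and t: "0 < t"
  shows "measure sphere_measure {\<theta> \<in> sphere 0 1. \<kappa> * t < norm (\<Omega> \<theta>)} \<le> t powr (- real CARD('n))"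
proof -
  let ?m = "measure sphere_measure {\<theta> \<in> sphere 0 1. \<kappa> * t < norm (\<Omega> \<theta>)}"
  let ?n = "real CARD('n)"
  have "ennreal ((\<kappa> * t) * ?m powr (1 / ?n)) \<le> weak_Ln_norm \<Omega>"
    unfolding weak_Ln_norm_def using \<kappa> t by (intro SUP_upper) simp
  also note \<kappa>(2)
  finally have "(\<kappa> * t) * ?m powr (1 / ?n) \<le> \<kappa>"
    using \<kappa> by (simp add: ennreal_le_iff)
  then have "\<kappa> * (t * ?m powr (1 / ?n)) \<le> \<kappa> * 1" by (simp add: mult.assoc)
  then have "t * ?m powr (1 / ?n) \<le> 1"
    using \<kappa> by (simp only: mult_le_cancel_left_pos)
  then have "?m powr (1 / ?n) \<le> t powr - 1"
    using t by (simp add: powr_minus_divide field_simps)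
  then have "(?m powr (1 / ?n)) powr ?n \<le> (t powr - 1) powr ?n"
    by (intro powr_mono2) auto
  moreover have "(?m powr (1 / ?n)) powr ?n = ?m"
    by (simp add: powr_powr)
  moreover have "(t powr - 1) powr ?n = t powr (- ?n)"
    by (simp only: powr_powr mult_minus_left mult_1_left)
  ultimately show ?thesis by simp
qed

text \<open>
  Homogeneity turns \<open>\<Omega>(y)\<close> into a function of \<open>y/|y|\<close>; a Borel representative of it, divided by
  \<open>\<kappa>\<close>, satisfies the normalised hypotheses of \<open>truncated_integral_le\<close>.  The number \<open>\<kappa>\<close> is any
  positive upper bound of the weak norm instead of the norm itself, because the norm may vanish.
\<close>

lemma maximal_rough_singular_integral_le:
  assumes dim: "2 \<le> CARD('n::finite)"
  obtains C :: real where "0 < C"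
    and "\<And>(\<Omega> :: real ^ 'n \<Rightarrow> complex) f x \<kappa>. homogeneous_deg_zero \<Omega> \<Longrightarrow> in_weak_Ln \<Omega> \<Longrightarrow>
      (LINT \<theta>|sphere_measure. \<Omega> \<theta>) = 0 \<Longrightarrow> test_function f \<Longrightarrow> 0 < \<kappa> \<Longrightarrow> weak_Ln_norm \<Omega> \<le> ennreal \<kappa> \<Longrightarrow>
      maximal_rough_singular_integral \<Omega> f x
        \<le> ennreal C * ennreal \<kappa> * ennreal (riesz_potential_1 (\<lambda>y. norm (gradient f y)) x)"
proof -
  let ?n = "CARD('n)"
  obtain C :: ennreal where C: "C < top"
    and truncated: "\<And>(\<Omega> :: real ^ 'n \<Rightarrow> complex) (f :: real ^ 'n \<Rightarrow> complex) f' g t x.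
      \<Omega> \<in> borel_measurable borel \<Longrightarrow>
      (\<And>t. 0 < t \<Longrightarrow> measure surface_measure {\<theta>. t < norm (\<Omega> \<theta>)} \<le> t powr (- real ?n)) \<Longrightarrow>
      (\<integral>\<theta>. \<Omega> \<theta> \<partial>surface_measure) = 0 \<Longrightarrow>
      (\<And>y. (f has_derivative f' y) (at y)) \<Longrightarrow> (\<And>y v. norm (f' y v) \<le> g y * norm v) \<Longrightarrow>
      continuous_on UNIV g \<Longrightarrow> 0 < t \<Longrightarrow>
      ennreal (norm (LINT y:{y. t < norm y}|lborel. \<Omega> (sgn y) / of_real (norm y ^ ?n) * f (x - y))) \<le>
        C * (\<integral>\<^sup>+y. ennreal (g y / norm (x - y) ^ (?n - 1)) \<partial>lborel)"
    by (rule truncated_integral_le[where 'a="real ^ 'n", unfolded DIM_cart DIM_real mult_1_right, OF dim],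
        rule that, assumption) blast
  have bound: "maximal_rough_singular_integral \<Omega> f x
      \<le> ennreal (enn2real C + 1) * ennreal \<kappa> * ennreal (riesz_potential_1 (\<lambda>y. norm (gradient f y)) x)"
    if hom: "homogeneous_deg_zero \<Omega>" and weak: "in_weak_Ln \<Omega>" and mean: "(LINT \<theta>|sphere_measure. \<Omega> \<theta>) = 0"
      and f: "test_function f" and \<kappa>: "0 < \<kappa>" "weak_Ln_norm \<Omega> \<le> ennreal \<kappa>"
    for \<Omega> :: "real ^ 'n \<Rightarrow> complex" and f x \<kappa>
    unfolding maximal_rough_singular_integral_def
  proof (rule SUP_least)
    fix t :: real assume "t \<in> {0<..}"
    then have t: "0 < t" by simp
    have \<Omega>: "\<Omega> \<in> borel_measurable sphere_measure" using weak by (simp add: in_weak_Ln_def)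
    obtain \<Omega>' where [measurable]: "\<Omega>' \<in> borel_measurable borel"
      and ae: "AE \<theta> in sphere_borel_measure. \<Omega> \<theta> = \<Omega>' \<theta>"
      using sphere_measurable_borel_representative[OF \<Omega>] .
    have \<Omega>'_sphere: "\<Omega>' \<in> borel_measurable sphere_borel_measure"
      using measurable_compose[OF measurable_ident_sphere_borel_measure, of \<Omega>' borel] by simp
    have ae': "AE \<theta> in sphere_measure. \<Omega> \<theta> = \<Omega>' \<theta>"
      unfolding sphere_measure_def by (rule AE_completion[OF ae])
    have \<Omega>'_completed: "\<Omega>' \<in> borel_measurable sphere_measure"
      using \<Omega>'_sphere unfolding sphere_measure_def by (rule measurable_completion)
    have "(\<integral>\<theta>. \<Omega>' \<theta> \<partial>surface_measure) = (LINT \<theta>|sphere_borel_measure. \<Omega>' \<theta>)"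
      unfolding distr_sphere_borel_measure[symmetric] by (subst integral_distr) (auto intro: measurable_ident_sphere_borel_measure)
    also have "\<dots> = (LINT \<theta>|sphere_measure. \<Omega>' \<theta>)"
      unfolding sphere_measure_def by (rule integral_completion[symmetric]) (rule \<Omega>'_sphere)
    also have "\<dots> = (LINT \<theta>|sphere_measure. \<Omega> \<theta>)"
      using ae' by (intro integral_cong_AE \<Omega> \<Omega>'_completed) (auto elim: eventually_mono)
    finally have mean': "(\<integral>\<theta>. \<Omega>' \<theta> / of_real \<kappa> \<partial>surface_measure) = 0"
      using mean by simp
    have weak': "measure surface_measure {\<theta>. s < norm (\<Omega>' \<theta> / of_real \<kappa>)} \<le> s powr (- real ?n)" if "0 < s" for s
    proof -
      have B: "{\<theta> \<in> sphere 0 1. \<kappa> * s < norm (\<Omega>' \<theta>)} \<in> sets sphere_borel_measure"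
      proof -
        have "{\<theta> \<in> space sphere_borel_measure. \<kappa> * s < norm (\<Omega>' \<theta>)} \<in> sets sphere_borel_measure"
          using \<Omega>'_sphere by measurable
        then show ?thesis by (simp add: space_sphere_borel_measure)
      qed
      have A: "{\<theta> \<in> sphere 0 1. \<kappa> * s < norm (\<Omega> \<theta>)} \<in> sets sphere_measure"
      proof -
        have "{\<theta> \<in> space sphere_measure. \<kappa> * s < norm (\<Omega> \<theta>)} \<in> sets sphere_measure"
          using \<Omega> by measurable
        then show ?thesis by (simp add: space_sphere_measure)
      qed
      have "{\<theta>. s < norm (\<Omega>' \<theta> / of_real \<kappa>)} = {\<theta>. \<kappa> * s < norm (\<Omega>' \<theta>)}"
        using \<kappa> by (simp add: norm_divide field_simps)
      then have "measure surface_measure {\<theta>. s < norm (\<Omega>' \<theta> / of_real \<kappa>)} =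
          measure (distr sphere_borel_measure borel (\<lambda>x. x)) {\<theta>. \<kappa> * s < norm (\<Omega>' \<theta>)}"
        by (simp add: distr_sphere_borel_measure)
      also have "\<dots> = measure sphere_borel_measure {\<theta> \<in> sphere 0 1. \<kappa> * s < norm (\<Omega>' \<theta>)}"
        by (subst measure_distr) (auto simp: measurable_ident_sphere_borel_measure space_sphere_borel_measure Int_def conj_commute intro!: arg_cong[where f="measure _"])
      also have "\<dots> = measure sphere_measure {\<theta> \<in> sphere 0 1. \<kappa> * s < norm (\<Omega>' \<theta>)}"
        using B unfolding sphere_measure_def by (simp add: measure_completion)
      also have "\<dots> = measure sphere_measure {\<theta> \<in> sphere 0 1. \<kappa> * s < norm (\<Omega> \<theta>)}"
        using ae' A B by (intro measure_eq_AE) (auto elim!: eventually_mono simp: sphere_measure_def)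
      also have "\<dots> \<le> s powr (- real ?n)"
        by (rule weak_Ln_norm_distribution[OF weak \<kappa> that])
      finally show ?thesis .
    qed
    have [measurable]: "f \<in> borel_measurable borel"
      using has_derivative_test_function[OF f]
      by (intro borel_measurable_continuous_onI continuous_at_imp_continuous_on) (auto intro: has_derivative_continuous)
    let ?F = "\<lambda>y. indicator {y. t < norm y} y *\<^sub>R (\<Omega> y / of_real (norm y ^ ?n) * f (x - y))"
    let ?F' = "\<lambda>y. indicator {y. t < norm y} y *\<^sub>R (\<Omega>' (sgn y) / of_real \<kappa> / of_real (norm y ^ ?n) * f (x - y))"
    have "ennreal (norm (integral\<^sup>L lebesgue ?F)) \<le> ennreal \<kappa> * ennreal (norm (integral\<^sup>L lborel ?F'))"
    \<comment> \<open>A function that is not measurable has integral zero by convention.\<close>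
    proof (cases "?F \<in> borel_measurable lebesgue")
      case True
      have "AE y in lebesgue. ?F y = of_real \<kappa> * ?F' y"
      proof (rule AE_completion)
        show "AE y in lborel. ?F y = of_real \<kappa> * ?F' y"
          using AE_lborel_sgn[OF ae]
        proof eventually_elim
          case (elim y)
          show ?case
          proof (cases "y = 0")
            case False
            have "\<Omega> (sgn y) = \<Omega> y"
              using hom False unfolding homogeneous_deg_zero_def sgn_div_norm by auto
            with elim False \<kappa> show ?thesis by (simp split: split_indicator)
          qed (use t in simp)
        qed
      qed
      then have "integral\<^sup>L lebesgue ?F = integral\<^sup>L lebesgue (\<lambda>y. of_real \<kappa> * ?F' y)"
        by (intro integral_cong_AE True measurable_completion) measurable
      also have "\<dots> = of_real \<kappa> * integral\<^sup>L lebesgue ?F'"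
        by (rule integral_mult_right_zero)
      also have "integral\<^sup>L lebesgue ?F' = integral\<^sup>L lborel ?F'"
        by (rule integral_completion) measurable
      finally show ?thesis
        using \<kappa> by (simp add: norm_mult ennreal_mult')
    next
      case False
      then have "\<not> integrable lebesgue ?F" by (auto dest: borel_measurable_integrable)
      then show ?thesis by (simp add: not_integrable_integral_eq)
    qed
    also have "\<dots> \<le> ennreal \<kappa> * (C * (\<integral>\<^sup>+y. ennreal (norm (gradient f y) / norm (x - y) ^ (?n - 1)) \<partial>lborel))"
    proof (rule mult_left_mono)
      show "ennreal (norm (integral\<^sup>L lborel ?F')) \<le>
          C * (\<integral>\<^sup>+y. ennreal (norm (gradient f y) / norm (x - y) ^ (?n - 1)) \<partial>lborel)"
        using truncated[of "\<lambda>\<theta>. \<Omega>' \<theta> / of_real \<kappa>", OF _ weak' mean' has_derivative_test_function[OF f]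
            norm_frechet_derivative_le[OF f] continuous_on_norm[OF continuous_on_gradient[OF f]] t, of x]
        unfolding set_lebesgue_integral_def by simp
    qed simp
    also have "\<dots> = C * ennreal \<kappa> * ennreal (riesz_potential_1 (\<lambda>y. norm (gradient f y)) x)"
      by (simp only: riesz_potential_gradient[OF dim f] mult_ac)
    also have "\<dots> \<le> ennreal (enn2real C + 1) * ennreal \<kappa> * ennreal (riesz_potential_1 (\<lambda>y. norm (gradient f y)) x)"
    proof (intro mult_right_mono)
      have "C = ennreal (enn2real C)" using C by simp
      also have "\<dots> \<le> ennreal (enn2real C + 1)" by (rule ennreal_leI) simp
      finally show "C \<le> ennreal (enn2real C + 1)" .
    qed auto
    finally show "ennreal (norm (LINT y:{y. t < norm y}|lebesgue. \<Omega> y / of_real (norm y ^ ?n) * f (x - y)))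
      \<le> ennreal (enn2real C + 1) * ennreal \<kappa> * ennreal (riesz_potential_1 (\<lambda>y. norm (gradient f y)) x)"
      unfolding set_lebesgue_integral_def .
  qed
  show thesis
    \<comment> \<open>The added one only makes the constant positive.\<close>
    by (rule that[of "enn2real C + 1"]) (simp add: add_nonneg_pos, rule bound)
qed

theorem theorem1p3:
  assumes "2 \<le> CARD('n::finite)"
  shows "\<exists>C::real. 0 < C \<and>
    (\<forall>(\<Omega> :: real ^ 'n \<Rightarrow> complex) (f :: real ^ 'n \<Rightarrow> complex) (x :: real ^ 'n).
       homogeneous_deg_zero \<Omega> \<longrightarrow> in_weak_Ln \<Omega> \<longrightarrow> (LINT \<theta>|sphere_measure. \<Omega> \<theta>) = 0 \<longrightarrow>
       test_function f \<longrightarrow>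
       maximal_rough_singular_integral \<Omega> f x
         \<le> ennreal C * weak_Ln_norm \<Omega> * ennreal (riesz_potential_1 (\<lambda>y. norm (gradient f y)) x))"
proof -
  obtain C :: real where C: "0 < C"
    and bound: "\<And>(\<Omega> :: real ^ 'n \<Rightarrow> complex) f x \<kappa>. homogeneous_deg_zero \<Omega> \<Longrightarrow> in_weak_Ln \<Omega> \<Longrightarrow>
      (LINT \<theta>|sphere_measure. \<Omega> \<theta>) = 0 \<Longrightarrow> test_function f \<Longrightarrow> 0 < \<kappa> \<Longrightarrow> weak_Ln_norm \<Omega> \<le> ennreal \<kappa> \<Longrightarrow>
      maximal_rough_singular_integral \<Omega> f x
        \<le> ennreal C * ennreal \<kappa> * ennreal (riesz_potential_1 (\<lambda>y. norm (gradient f y)) x)"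
    by (rule maximal_rough_singular_integral_le[OF assms], rule that, assumption) blast
  have "maximal_rough_singular_integral \<Omega> f x
      \<le> ennreal C * weak_Ln_norm \<Omega> * ennreal (riesz_potential_1 (\<lambda>y. norm (gradient f y)) x)"
    if "homogeneous_deg_zero \<Omega>" "in_weak_Ln \<Omega>" "(LINT \<theta>|sphere_measure. \<Omega> \<theta>) = 0" "test_function f"
    for \<Omega> f :: "real ^ 'n \<Rightarrow> complex" and x
  proof -
    define N where "N = enn2real (weak_Ln_norm \<Omega>)"
    define I where "I = riesz_potential_1 (\<lambda>y. norm (gradient f y)) x"
    have I: "0 \<le> I" by (simp add: I_def riesz_potential_1_def)
    have N: "weak_Ln_norm \<Omega> = ennreal N" "0 \<le> N"
      using that(2) by (simp_all add: N_def in_weak_Ln_def)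
    \<comment> \<open>The bound \<open>N + \<epsilon>\<close> of the weak norm is positive even if \<open>N = 0\<close>; let \<open>\<epsilon>\<close> tend to zero.\<close>
    have *: "maximal_rough_singular_integral \<Omega> f x \<le> ennreal (C * (N + \<epsilon>) * I)" if "0 < \<epsilon>" for \<epsilon>
    proof -
      have "ennreal N \<le> ennreal (N + \<epsilon>)" using \<open>0 < \<epsilon>\<close> by (intro ennreal_leI) simp
      moreover have "0 < N + \<epsilon>" using N \<open>0 < \<epsilon>\<close> by simp
      ultimately show ?thesis
        using bound[of \<Omega> f "N + \<epsilon>" x] \<open>homogeneous_deg_zero \<Omega>\<close> \<open>in_weak_Ln \<Omega>\<close> \<open>test_function f\<close>
          \<open>(LINT \<theta>|sphere_measure. \<Omega> \<theta>) = 0\<close> C I N \<open>0 < \<epsilon>\<close>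
        by (simp add: I_def ennreal_mult)
    qed
    have "maximal_rough_singular_integral \<Omega> f x \<le> ennreal (C * N * I)"
    proof (rule tendsto_lowerbound)
      have "((\<lambda>\<epsilon>. C * (N + \<epsilon>) * I) \<longlongrightarrow> C * (N + 0) * I) (at_right 0)"
        by (intro tendsto_intros)
      then show "((\<lambda>\<epsilon>. ennreal (C * (N + \<epsilon>) * I)) \<longlongrightarrow> ennreal (C * N * I)) (at_right 0)"
        by (intro tendsto_ennrealI) simp
      show "\<forall>\<^sub>F \<epsilon> in at_right 0. maximal_rough_singular_integral \<Omega> f x \<le> ennreal (C * (N + \<epsilon>) * I)"
        using eventually_at_right_less[of "0::real"] by eventually_elim (rule *)
    qed simp
    then show ?thesis
      using C N I by (simp add: I_def[symmetric] ennreal_mult)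
  qed
  with C show ?thesis by blast
qed

end
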